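(* Let $\mathcal{G}=(\mathcal{V},\mathcal{E})$ be a finite hypergraph with arrival rates $\lambda_e>0$ ($e\in\mathcal{E}$) and service rates $\mu_v>0$ ($v\in\mathcal{V}$), and consider the queueing system on $\mathcal{G}$ under the dynamic (join-the-shortest-queue) allocation. This system is stable if and only if there exists a stable static allocation, i.e., if and only if $$\min_{\mathbf{P}}\left(\max_{v\in\mathcal{V}}\frac{1}{\mu_v}\sum_{e\in\mathcal{E}(v)}p_{v,e}\lambda_e\right)<1,$$ where the minimum is over all static allocations $\mathbf{P}=\{\{p_{v,e}\}_{v\in e}\}_{e\in\mathcal{E}}$.
   Context: **Hypergraph.** $\mathcal{V}$ is a finite nonempty set of vertices and $\mathcal{E}$ is a finite set of edges, each edge $e\in\mathcal{E}$ being a nonempty subset of $\mathcal{V}$. For $v\in\mathcal{V}$, $\mathcal{E}(v)=\{e\in\mathcal{E}: v\in e\}$. **Queueing system.** For each edge $e$, customers of class $e$ arrive according to a Poisson process of rate $\lambda_e>0$; the processes for different edges are independent. At each vertex $v$ there is a single server with an infinite-capacity FIFO queue; $Q_v(t)$ denotes the number of customers at vertex $v$ at time $t$ (including the one in service). Each customer served at $v$, whatever its class, requires an exponential service time of rate $\mu_v>0$, all service times being independent of each other and of the arrivals. A customer of class $e$ can be served by any server at a vertex $v\in e$; on arrival it is immediately allocated to one such vertex and joins its queue. **Static allocation.** A static allocation is a family $\mathbf{P}=\{\{p_{v,e}\}_{v\in e}\}_{e\in\mathcal{E}}$ with $p_{v,e}\ge 0$ and $\sum_{v\in e}p_{v,e}=1$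 for every $e\in\mathcal{E}$. Under it, a customer arriving on edge $e$ is allocated to $v\in e$ with probability $p_{v,e}$, independently of everything else. So $Q(t)=(Q_v(t))_{v\in\mathcal{V}}$ is a continuous-time Markov chain on $\mathbb{Z}_{\ge0}^{\mathcal{V}}$ with transitions $x\to x+\mathbf{1}_v$ at rate $\sum_{e\in\mathcal{E}(v)}p_{v,e}\lambda_e$ and $x\to x-\mathbf{1}_v$ at rate $\mu_v$ if $x_v>0$, where $\mathbf{1}_v$ is the unit vector at $v$. **Dynamic (JSQ) allocation.** A customer arriving on edge $e$ joins the shortest queue among those at vertices $v\in e$; if several have the smallest size, one of them is chosen uniformly at random. So $Q(t)$ is a continuous-time Markov chain on $\mathbb{Z}_{\ge0}^{\mathcal{V}}$ with transitions $x\to x-\mathbf{1}_v$ at rate $\mu_v$ if $x_v>0$, and $x\to x+\mathbf{1}_v$ at rate $\sum_{e\in\mathcal{E}(v)} \lambda_e\,\frac{\mathbf{1}\{x_v=m_e(x)\}}{|\{u\in e:\,x_u=m_e(x)\}|}$, where $m_e(x)=\min_{u\in e}x_u$. **Stability.** A system (under a given static allocation, or under the dynamic allocation) is called stable if its queue-length Markov chain $Q(t)$ is positive recurrent, understood as: it possesses a stationary probability distribution. (Every state leads to the empty state, so there is at most one closed communicating class with positive recurrent states, the one containing the empty state, and any stationary distribution is unique.) *)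

theory Defs
  imports "HOL-Probability.Probability"
begin

text \<open>
  The vertex set is a finite type, a hypergraph on it is a set of nonempty subsets, and a state
  \<open>x :: 'v \<Rightarrow> nat\<close> gives the queue length at each vertex.

  A continuous-time Markov chain is represented by its transition probabilities: \<open>P t x\<close> is the law
  at time \<open>t\<close> of the chain started in \<open>x\<close>. The last two conditions say that \<open>q x y\<close>
  (\<open>y \<noteq> x\<close>) is the rate of the transition from \<open>x\<close> to \<open>y\<close>, and that the total rate of leaving
  \<open>x\<close> is the sum of these; the values \<open>q x x\<close> play no role. When the total rates are bounded, as
  they are for all chains below, there is exactly one such \<open>P\<close>.
\<close>

definition markov_chain_with_rates ::
  "('s \<Rightarrow> 's \<Rightarrow> real) \<Rightarrow> (real \<Rightarrow> 's \<Rightarrow> 's pmf) \<Rightarrow> bool" where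
  "markov_chain_with_rates q P \<longleftrightarrow>
     (\<forall>x. P 0 x = return_pmf x) \<and>
     (\<forall>s\<ge>0. \<forall>t\<ge>0. \<forall>x. P (s + t) x = bind_pmf (P s x) (P t)) \<and>
     (\<forall>x y. y \<noteq> x \<longrightarrow> ((\<lambda>t. pmf (P t x) y / t) \<longlongrightarrow> q x y) (at_right 0)) \<and>
     (\<forall>x. ((\<lambda>t. (1 - pmf (P t x) x) / t) \<longlongrightarrow> (\<Sum>\<^sub>\<infinity>y\<in>- {x}. q x y)) (at_right 0))"

definition stationary_distribution :: "(real \<Rightarrow> 's \<Rightarrow> 's pmf) \<Rightarrow> 's pmf \<Rightarrow> bool" where
  "stationary_distribution P \<pi> \<longleftrightarrow> (\<forall>t\<ge>0. bind_pmf \<pi> (P t) = \<pi>)"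

definition stable_chain :: "('s \<Rightarrow> 's \<Rightarrow> real) \<Rightarrow> bool" where
  "stable_chain q \<longleftrightarrow> (\<exists>P. markov_chain_with_rates q P \<and> (\<exists>\<pi>. stationary_distribution P \<pi>))"

text \<open>
  Transition rates of the queue lengths when customers join vertex \<open>v\<close> at rate \<open>a x v\<close> in state
  \<open>x\<close>. For given \<open>x\<close> and \<open>y\<close>, at most one of the summands is present.
\<close>

definition queue_rates ::
  "(('v::finite \<Rightarrow> nat) \<Rightarrow> 'v \<Rightarrow> real) \<Rightarrow> ('v \<Rightarrow> real) \<Rightarrow> ('v \<Rightarrow> nat) \<Rightarrow> ('v \<Rightarrow> nat) \<Rightarrow> real" where
  "queue_rates a mu x y =
     (\<Sum>v | y = x(v := x v + 1). a x v) +
     (\<Sum>v | x v > 0 \<and> y = x(v := x v - 1). mu v)"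

definition edges_at :: "'v set set \<Rightarrow> 'v \<Rightarrow> 'v set set" where
  "edges_at E v = {e \<in> E. v \<in> e}"

text \<open>
  An allocation \<open>p\<close> assigns to \<open>v\<close> and \<open>e\<close> the probability \<open>p v e\<close>; its values for
  \<open>e \<notin> E\<close> or \<open>v \<notin> e\<close> are never used.
\<close>

definition static_allocation :: "'v set set \<Rightarrow> ('v \<Rightarrow> 'v set \<Rightarrow> real) \<Rightarrow> bool" where
  "static_allocation E p \<longleftrightarrow> (\<forall>e\<in>E. (\<forall>v\<in>e. p v e \<ge> 0) \<and> (\<Sum>v\<in>e. p v e) = 1)"

definition static_arrival ::
  "'v set set \<Rightarrow> ('v set \<Rightarrow> real) \<Rightarrow> ('v \<Rightarrow> 'v set \<Rightarrow> real) \<Rightarrow> 'v \<Rightarrow> real" where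
  "static_arrival E lam p v = (\<Sum>e\<in>edges_at E v. p v e * lam e)"

definition static_rates ::
  "'v::finite set set \<Rightarrow> ('v set \<Rightarrow> real) \<Rightarrow> ('v \<Rightarrow> real) \<Rightarrow> ('v \<Rightarrow> 'v set \<Rightarrow> real) \<Rightarrow>
   ('v \<Rightarrow> nat) \<Rightarrow> ('v \<Rightarrow> nat) \<Rightarrow> real" where
  "static_rates E lam mu p = queue_rates (\<lambda>x. static_arrival E lam p) mu"

definition shortest_queues :: "('v \<Rightarrow> nat) \<Rightarrow> 'v set \<Rightarrow> 'v set" where
  "shortest_queues x e = {u \<in> e. x u = Min (x ` e)}"

definition jsq_arrival ::
  "'v set set \<Rightarrow> ('v set \<Rightarrow> real) \<Rightarrow> ('v \<Rightarrow> nat) \<Rightarrow> 'v \<Rightarrow> real" where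
  "jsq_arrival E lam x v =
     (\<Sum>e\<in>edges_at E v.
        lam e * (of_bool (v \<in> shortest_queues x e) / real (card (shortest_queues x e))))"

definition jsq_rates ::
  "'v::finite set set \<Rightarrow> ('v set \<Rightarrow> real) \<Rightarrow> ('v \<Rightarrow> real) \<Rightarrow>
   ('v \<Rightarrow> nat) \<Rightarrow> ('v \<Rightarrow> nat) \<Rightarrow> real" where
  "jsq_rates E lam mu = queue_rates (jsq_arrival E lam) mu"

definition max_load ::
  "'v::finite set set \<Rightarrow> ('v set \<Rightarrow> real) \<Rightarrow> ('v \<Rightarrow> real) \<Rightarrow> ('v \<Rightarrow> 'v set \<Rightarrow> real) \<Rightarrow> real" where
  "max_load E lam mu p = (MAX v. 1 / mu v * (\<Sum>e\<in>edges_at E v. p v e * lam e))"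

end

theory Submission
  imports Defs "HOL-Real_Asymp.Real_Asymp" "HOL-Complex_Analysis.Great_Picard"
begin

text \<open>
  Both kinds of stability are equivalent to the existence of a static allocation \<open>p\<close> of which all
  loads are less than \<open>1\<close>.

  Necessity: under a stationary distribution \<open>\<pi>\<close>, the probability flow across the cut
  \<open>{x. x v \<le> n}\<close> balances. Summing over \<open>n\<close> shows that the mean arrival rate at \<open>v\<close> is
  \<open>mu v * \<pi> {x. x v > 0}\<close>, which is less than \<open>mu v\<close> because by the same equations \<open>\<pi> {x. x v = 0}\<close>
  cannot vanish. For the shortest-queue chain the mean arrival rates are those of the static
  allocation obtained by averaging the routing probabilities under \<open>\<pi>\<close>.

  Sufficiency: sending customers to the shortest queue minimizes the drift of
  \<open>\<Sum>v. (x v)\<^sup>2\<close> among all allocations, so a static allocation with loads less than \<open>1\<close> makes this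
  drift negative outside a finite set. An invariant distribution of the uniformized jump chain then
  arises as a limit of Cesaro averages, and it is stationary for the chain that makes the same
  jumps at the times of a Poisson process.
\<close>

section \<open>Measures and integrals of discrete distributions\<close>

lemma measure_pmf_conv_infsum: "measure (measure_pmf p) A = (\<Sum>\<^sub>\<infinity>y\<in>A. pmf p y)"
  by (simp add: measure_pmf_conv_infsetsum infsetsum_infsum pmf_abs_summable)

lemma measure_bind_pmf:
  "measure (measure_pmf (bind_pmf M f)) A = (\<integral>x. measure (measure_pmf (f x)) A \<partial>measure_pmf M)"
proof -
  have "ennreal (measure (measure_pmf (bind_pmf M f)) A) = emeasure (measure_pmf (bind_pmf M f)) A"
    by (simp add: measure_pmf.emeasure_eq_measure)
  also have "\<dots> = (\<integral>\<^sup>+x. emeasure (measure_pmf (f x)) A \<partial>measure_pmf M)"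
    by (rule emeasure_bind_pmf)
  also have "\<dots> = (\<integral>\<^sup>+x. ennreal (measure (measure_pmf (f x)) A) \<partial>measure_pmf M)"
    by (simp add: measure_pmf.emeasure_eq_measure)
  also have "\<dots> = ennreal (\<integral>x. measure (measure_pmf (f x)) A \<partial>measure_pmf M)"
    by (intro nn_integral_eq_integral measure_pmf.integrable_const_bound[where B = 1]) auto
  finally show ?thesis
    by (simp add: integral_nonneg_AE)
qed

lemma integrable_measure_pmf_bounded:
  fixes f :: "'a \<Rightarrow> real"
  assumes "\<And>x. \<bar>f x\<bar> \<le> B"
  shows "integrable (measure_pmf M) f"
  by (rule measure_pmf.integrable_const_bound[where B = B]) (use assms in auto)

subsection \<open>Uniformization\<close>

text \<open>The number of jumps of a Poisson process in an interval of mean count \<open>r\<close>.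
  The case \<open>r = 0\<close> is split off because time \<open>0\<close> has to be covered,
  whereas \<open>poisson_pmf\<close> is a Poisson law only for positive parameters.\<close>

definition poisson_jumps :: "real \<Rightarrow> nat pmf" where
  "poisson_jumps r = (if r > 0 then poisson_pmf r else return_pmf 0)"

lemma pmf_poisson_jumps:
  assumes "r \<ge> 0"
  shows "pmf (poisson_jumps r) k = r ^ k / fact k * exp (- r)"
  using assms by (cases "r = 0"; cases k) (auto simp: poisson_jumps_def)

text \<open>Convolving two Poisson laws gives the binomial expansion of \<open>(a + b) ^ n\<close>.
  This is the source of the semigroup property of the uniformized chain.\<close>

lemma poisson_jumps_add:
  assumes "a \<ge> 0" "b \<ge> 0"
  shows "poisson_jumps (a + b) =
    bind_pmf (poisson_jumps a) (\<lambda>m. map_pmf (\<lambda>n. m + n) (poisson_jumps b))"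
proof (rule pmf_eqI)
  fix n
  have shift: "pmf (map_pmf (\<lambda>k. m + k) (poisson_jumps b)) n =
      (if m \<le> n then pmf (poisson_jumps b) (n - m) else 0)" for m
  proof (cases "m \<le> n")
    case True
    have "pmf (map_pmf (\<lambda>k. m + k) (poisson_jumps b)) (m + (n - m)) = pmf (poisson_jumps b) (n - m)"
      by (rule pmf_map_inj') auto
    with True show ?thesis by simp
  next
    case False
    then show ?thesis by (auto intro!: pmf_map_outside)
  qed
  have "pmf (bind_pmf (poisson_jumps a) (\<lambda>m. map_pmf (\<lambda>n. m + n) (poisson_jumps b))) n =
      (\<Sum>m\<le>n. (if m \<le> n then pmf (poisson_jumps b) (n - m) else 0) * pmf (poisson_jumps a) m)"
    unfolding pmf_bind shift by (rule integral_measure_pmf_real) (auto split: if_splits)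
  also have "\<dots> = (\<Sum>m\<le>n. exp (- (a + b)) / fact n * (real (n choose m) * a ^ m * b ^ (n - m)))"
    using assms
    by (intro sum.cong refl) (auto simp: pmf_poisson_jumps binomial_fact mult_exp_exp field_simps)
  also have "\<dots> = exp (- (a + b)) / fact n * (a + b) ^ n"
    by (simp only: binomial_ring sum_distrib_left)
  finally show "pmf (poisson_jumps (a + b)) n =
      pmf (bind_pmf (poisson_jumps a) (\<lambda>m. map_pmf (\<lambda>n. m + n) (poisson_jumps b))) n"
    using assms by (simp add: pmf_poisson_jumps)
qed

text \<open>In a short time \<open>t\<close> there is one jump with probability
  \<open>L * t + o(t)\<close> and more than one with probability \<open>o(t)\<close>. Since
  \<open>g 0 = 0\<close> and \<open>g\<close> has values in \<open>[0, 1]\<close>, the expectation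
  is squeezed between the one-jump term and that term plus the probability of at least two
  jumps.\<close>

lemma poisson_jumps_limit:
  fixes g :: "nat \<Rightarrow> real"
  assumes g: "\<And>n. 0 \<le> g n" "\<And>n. g n \<le> 1" and g0: "g 0 = 0" and L: "L > 0"
  shows "((\<lambda>t. (\<integral>n. g n \<partial>measure_pmf (poisson_jumps (L * t))) / t) \<longlongrightarrow> L * g 1) (at_right 0)"
proof -
  have bounds:
    "exp (- r) * r * g 1 \<le> (\<integral>n. g n \<partial>measure_pmf (poisson_jumps r))"
    "(\<integral>n. g n \<partial>measure_pmf (poisson_jumps r)) \<le>
       exp (- r) * r * g 1 + (1 - exp (- r) - exp (- r) * r)" if "r > 0" for r
  proof -
    let ?M = "measure_pmf (poisson_jumps r)"
    have ind: "(\<integral>n. indicat_real {k} n \<partial>?M) = pmf (poisson_jumps r) k" for k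
      by (simp add: measure_pmf_single)
    have int: "integrable ?M g" "integrable ?M (indicat_real A)" for A
      by (auto intro!: integrable_measure_pmf_bounded[where B = 1] simp: g split: split_indicator)
    have "(\<integral>n. g 1 * indicat_real {1} n \<partial>?M) \<le> (\<integral>n. g n \<partial>?M)"
      by (intro integral_mono int integrable_mult_right) (auto simp: g split: split_indicator)
    then show "exp (- r) * r * g 1 \<le> (\<integral>n. g n \<partial>?M)"
      using that ind[of 1] by (simp add: pmf_poisson_jumps mult_ac)
    have "(\<integral>n. g n \<partial>?M) \<le>
        (\<integral>n. g 1 * indicat_real {1} n + (1 - indicat_real {0} n - indicat_real {1} n) \<partial>?M)"
      by (intro integral_mono int integrable_mult_right Bochner_Integration.integrable_add
          Bochner_Integration.integrable_diff)
         (auto simp: g g0 split: split_indicator)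
    also have "\<dots> = g 1 * pmf (poisson_jumps r) 1 +
        (1 - pmf (poisson_jumps r) 0 - pmf (poisson_jumps r) 1)"
      using int(2) by (simp add: measure_pmf_single)
    finally show "(\<integral>n. g n \<partial>?M) \<le> exp (- r) * r * g 1 + (1 - exp (- r) - exp (- r) * r)"
      using that by (simp add: pmf_poisson_jumps mult_ac)
  qed
  show ?thesis
  proof (rule tendsto_sandwich)
    show "\<forall>\<^sub>F t in at_right 0. exp (- (L * t)) * (L * t) * g 1 / t
        \<le> (\<integral>n. g n \<partial>measure_pmf (poisson_jumps (L * t))) / t"
      by (rule eventually_at_rightI[of 0 1], rule divide_right_mono, rule bounds(1)) (use L in auto)
    show "\<forall>\<^sub>F t in at_right 0. (\<integral>n. g n \<partial>measure_pmf (poisson_jumps (L * t))) / t \<le>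
        (exp (- (L * t)) * (L * t) * g 1 + (1 - exp (- (L * t)) - exp (- (L * t)) * (L * t))) / t"
      by (rule eventually_at_rightI[of 0 1], rule divide_right_mono, rule bounds(2)) (use L in auto)
    show "((\<lambda>t. exp (- (L * t)) * (L * t) * g 1 / t) \<longlongrightarrow> L * g 1) (at_right 0)"
      using L by real_asymp
    show "((\<lambda>t. (exp (- (L * t)) * (L * t) * g 1 +
        (1 - exp (- (L * t)) - exp (- (L * t)) * (L * t))) / t) \<longlongrightarrow> L * g 1) (at_right 0)"
      using L by real_asymp
  qed
qed

section \<open>Discrete chains run at the times of a Poisson process\<close>

primrec iterate_kernel :: "('s \<Rightarrow> 's pmf) \<Rightarrow> nat \<Rightarrow> 's \<Rightarrow> 's pmf" where
  "iterate_kernel K 0 x = return_pmf x"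
| "iterate_kernel K (Suc n) x = bind_pmf (iterate_kernel K n x) K"

lemma iterate_kernel_add:
  "iterate_kernel K (m + n) x = bind_pmf (iterate_kernel K m x) (iterate_kernel K n)"
proof (induction n)
  case 0
  have "iterate_kernel K 0 = return_pmf" by auto
  then show ?case by (simp add: bind_return_pmf')
next
  case (Suc n)
  have "iterate_kernel K (Suc n) = (\<lambda>y. bind_pmf (iterate_kernel K n y) K)" by auto
  with Suc show ?case by (simp add: bind_assoc_pmf)
qed

lemma iterate_kernel_invariant:
  assumes "bind_pmf \<pi> K = \<pi>"
  shows "bind_pmf \<pi> (iterate_kernel K n) = \<pi>"
proof (induction n)
  case 0
  have "iterate_kernel K 0 = return_pmf" by auto
  then show ?case by (simp add: bind_return_pmf')
next
  case (Suc n)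
  have "iterate_kernel K (Suc n) = (\<lambda>y. bind_pmf (iterate_kernel K n y) K)" by auto
  with Suc assms show ?case by (simp add: bind_assoc_pmf[symmetric])
qed

definition uniformized :: "real \<Rightarrow> ('s \<Rightarrow> 's pmf) \<Rightarrow> real \<Rightarrow> 's \<Rightarrow> 's pmf" where
  "uniformized L K t x = bind_pmf (poisson_jumps (L * t)) (\<lambda>n. iterate_kernel K n x)"

text \<open>With no jump the chain is still at \<open>x\<close>, outside \<open>A\<close>, so the
  term of first order comes from a single jump. General sets are allowed because singletons give the
  individual rates and the complement of \<open>{x}\<close> gives the total rate.\<close>

lemma uniformized_limit:
  assumes "L > 0" "x \<notin> A"
  shows "((\<lambda>t. measure (measure_pmf (uniformized L K t x)) A / t) \<longlongrightarrow>
           L * measure (measure_pmf (K x)) A) (at_right 0)"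
proof -
  let ?g = "\<lambda>n. measure (measure_pmf (iterate_kernel K n x)) A"
  have "?g 0 = 0" "?g 1 = measure (measure_pmf (K x)) A"
    using assms(2) by (simp_all add: bind_return_pmf)
  with poisson_jumps_limit[of ?g L] assms(1) show ?thesis
    by (simp add: uniformized_def measure_bind_pmf)
qed

lemma uniformized_semigroup:
  assumes "L > 0" "s \<ge> 0" "t \<ge> 0"
  shows "uniformized L K (s + t) x = bind_pmf (uniformized L K s x) (uniformized L K t)"
proof -
  have "uniformized L K (s + t) x = bind_pmf (poisson_jumps (L * s)) (\<lambda>m.
      bind_pmf (poisson_jumps (L * t)) (\<lambda>n. bind_pmf (iterate_kernel K m x) (iterate_kernel K n)))"
    using assms
    by (simp add: uniformized_def distrib_left poisson_jumps_add bind_assoc_pmf bind_map_pmf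
        iterate_kernel_add)
  \<comment> \<open>The second jump count is independent of the state reached after the first
    \<open>m\<close> jumps, so the two may be drawn in either order.\<close>
  also have "\<dots> = bind_pmf (poisson_jumps (L * s)) (\<lambda>m. bind_pmf (iterate_kernel K m x)
      (\<lambda>y. bind_pmf (poisson_jumps (L * t)) (\<lambda>n. iterate_kernel K n y)))"
    by (subst bind_commute_pmf) simp
  finally show ?thesis
    by (simp add: uniformized_def[abs_def] bind_assoc_pmf)
qed

lemma markov_chain_uniformized:
  assumes L: "L > 0" and q: "\<And>x y. y \<noteq> x \<Longrightarrow> q x y = L * pmf (K x) y"
  shows "markov_chain_with_rates q (uniformized L K)"
  unfolding markov_chain_with_rates_def
proof (intro conjI allI impI)
  fix x
  show "uniformized L K 0 x = return_pmf x"
    by (simp add: uniformized_def poisson_jumps_def bind_return_pmf)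
next
  fix s t :: real and x assume "s \<ge> 0" "t \<ge> 0"
  then show "uniformized L K (s + t) x = bind_pmf (uniformized L K s x) (uniformized L K t)"
    by (rule uniformized_semigroup[OF L])
next
  fix x y :: 'a assume "y \<noteq> x"
  with uniformized_limit[OF L, of x "{y}" K]
  show "((\<lambda>t. pmf (uniformized L K t x) y / t) \<longlongrightarrow> q x y) (at_right 0)"
    by (simp add: measure_pmf_single q)
next
  fix x
  have "(\<Sum>\<^sub>\<infinity>y\<in>- {x}. q x y) = (\<Sum>\<^sub>\<infinity>y\<in>- {x}. L * pmf (K x) y)"
    by (intro infsum_cong) (simp add: q)
  also have "\<dots> = L * measure (measure_pmf (K x)) (- {x})"
    by (simp add: measure_pmf_conv_infsum infsum_cmult_right')
  finally have total: "(\<Sum>\<^sub>\<infinity>y\<in>- {x}. q x y) = L * measure (measure_pmf (K x)) (- {x})" .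
  have compl: "1 - pmf M x = measure (measure_pmf M) (- {x})" for M
    using measure_pmf.prob_compl[of "{x}" M] by (simp add: measure_pmf_single Compl_eq_Diff_UNIV)
  show "((\<lambda>t. (1 - pmf (uniformized L K t x) x) / t) \<longlongrightarrow> (\<Sum>\<^sub>\<infinity>y\<in>- {x}. q x y)) (at_right 0)"
    unfolding total compl by (rule uniformized_limit[OF L]) simp
qed

text \<open>An invariant law of the jump chain survives any fixed number of jumps, hence also an
  independent random number of them.\<close>

lemma stable_chain_of_invariant:
  assumes "L > 0" "\<And>x y. y \<noteq> x \<Longrightarrow> q x y = L * pmf (K x) y" "bind_pmf \<pi> K = \<pi>"
  shows "stable_chain q"
proof -
  have "bind_pmf \<pi> (uniformized L K t) = \<pi>" for t
    unfolding uniformized_def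
    by (subst bind_commute_pmf) (simp add: iterate_kernel_invariant[OF assms(3)])
  then show ?thesis
    using markov_chain_uniformized[of L q K] assms
    unfolding stable_chain_def stationary_distribution_def by blast
qed

subsection \<open>Invariant distributions from a drift condition\<close>

text \<open>Both sides have total mass \<open>1\<close>, so a deficit at one point could not be made
  up elsewhere. Thanks to this a subinvariant distribution is already invariant.\<close>

lemma pmf_le_imp_eq:
  assumes "\<And>y. pmf M y \<le> pmf N y"
  shows "M = N"
  using pmf_neq_exists_less[of N M] assms by (auto simp: not_less[symmetric])

lemma finite_set_iterate_kernel:
  assumes "\<And>x. finite (set_pmf (K x))"
  shows "finite (set_pmf (iterate_kernel K n x))"
  by (induction n) (use assms in auto)

text \<open>Finite supports take the place of boundedness, since \<open>h\<close> will be one of the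
  possibly unbounded functions \<open>V\<close> and \<open>f\<close>.\<close>

lemma expectation_bind_pmf_finite:
  fixes h :: "'b \<Rightarrow> real"
  assumes "finite (set_pmf p)" "\<And>x. finite (set_pmf (f x))"
  shows "measure_pmf.expectation (bind_pmf p f) h =
    measure_pmf.expectation p (\<lambda>x. measure_pmf.expectation (f x) h)"
proof -
  have "measure_pmf.expectation (bind_pmf p f) h =
      (\<Sum>a\<in>set_pmf p. pmf p a *\<^sub>R measure_pmf.expectation (f a) h)"
    by (rule pmf_expectation_bind) (use assms in auto)
  also have "\<dots> = measure_pmf.expectation p (\<lambda>x. measure_pmf.expectation (f x) h)"
    by (rule integral_measure_pmf[symmetric]) (use assms in auto)
  finally show ?thesis .
qed

text \<open>The drift inequality, averaged over the law at time \<open>k\<close>, telescopes in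
  \<open>k\<close>; the final value of \<open>V\<close> is dropped because it is
  nonnegative.\<close>

lemma drift_iterates:
  fixes K :: "'s \<Rightarrow> 's pmf" and V f :: "'s \<Rightarrow> real"
  assumes fin: "\<And>x. finite (set_pmf (K x))"
    and V: "\<And>x. V x \<ge> 0"
    and drift: "\<And>x. (\<integral>y. V y \<partial>measure_pmf (K x)) \<le> V x + c - f x"
  shows "(\<Sum>k<n. \<integral>y. f y \<partial>measure_pmf (iterate_kernel K k x)) \<le> V x + real n * c"
proof -
  let ?E = "\<lambda>k h. (\<integral>y. h y \<partial>measure_pmf (iterate_kernel K k x))"
  have int: "integrable (measure_pmf (iterate_kernel K k x)) h" for k and h :: "'s \<Rightarrow> real"
    by (intro integrable_measure_pmf_finite finite_set_iterate_kernel fin)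
  have step: "?E (Suc k) V \<le> ?E k V + c - ?E k f" for k
  proof -
    have "?E (Suc k) V = ?E k (\<lambda>y. \<integral>z. V z \<partial>measure_pmf (K y))"
      by (simp add: expectation_bind_pmf_finite finite_set_iterate_kernel fin)
    also have "\<dots> \<le> ?E k (\<lambda>y. V y + c - f y)"
      by (intro integral_mono int drift)
    also have "\<dots> = ?E k V + c - ?E k f"
      by (simp add: int)
    finally show ?thesis .
  qed
  have "(\<Sum>k<n. ?E k f) \<le> V x + real n * c - ?E n V"
  proof (induction n)
    case (Suc n)
    with step[of n] show ?case by (simp add: algebra_simps)
  qed simp
  moreover have "?E n V \<ge> 0"
    by (simp add: V integral_nonneg_AE)
  ultimately show ?thesis by simp
qed

text \<open>Foster's criterion by the Krylov-Bogoliubov method. The drift bounds the Cesaro averages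
  of \<open>f\<close>, whose sublevel sets are finite, so the averaged laws are tight and a
  pointwise limit keeps its total mass. One more step of the chain changes an averaged law by
  \<open>O(1/n)\<close>, which makes the limit invariant.\<close>

lemma drift_imp_invariant_distribution:
  fixes K :: "'s::countable \<Rightarrow> 's pmf" and V f :: "'s \<Rightarrow> real"
  assumes fin: "\<And>x. finite (set_pmf (K x))"
    and V: "\<And>x. V x \<ge> 0"
    and f: "\<And>x. f x \<ge> 0" "\<And>R. finite {x. f x \<le> R}"
    and drift: "\<And>x. (\<integral>y. V y \<partial>measure_pmf (K x)) \<le> V x + c - f x"
  shows "\<exists>\<pi>. bind_pmf \<pi> K = \<pi>"
proof -
  obtain x0 :: 's where True by simp
  let ?law = "\<lambda>k. iterate_kernel K k x0"
  define \<nu> where "\<nu> n = bind_pmf (pmf_of_set {..n}) ?law" for n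
  define B where "B = V x0 + \<bar>c\<bar>"
  have fin_\<nu>: "finite (set_pmf (\<nu> n))" for n
    by (simp add: \<nu>_def finite_set_iterate_kernel fin)
  have int: "integrable (measure_pmf (\<nu> n)) h" for n and h :: "'s \<Rightarrow> real"
    by (intro integrable_measure_pmf_finite fin_\<nu>)
  have Ef: "(\<integral>y. f y \<partial>measure_pmf (\<nu> n)) \<le> B" for n
  proof -
    have "(\<integral>y. f y \<partial>measure_pmf (\<nu> n)) = (\<Sum>k\<le>n. \<integral>y. f y \<partial>measure_pmf (?law k)) / real (Suc n)"
      unfolding \<nu>_def
      by (subst expectation_bind_pmf_finite)
         (simp_all add: finite_set_iterate_kernel fin integral_pmf_of_set)
    also have "\<dots> \<le> (V x0 + real (Suc n) * c) / real (Suc n)"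
      using drift_iterates[OF fin V drift, where n = "Suc n" and x = x0]
      by (intro divide_right_mono) (simp_all only: lessThan_Suc_atMost of_nat_0_le_iff)
    also have "\<dots> \<le> B"
    proof -
      have "V x0 \<le> V x0 * real (Suc n)"
        using V[of x0] by (simp add: algebra_simps)
      moreover have "real (Suc n) * c \<le> real (Suc n) * \<bar>c\<bar>"
        by (intro mult_left_mono) auto
      ultimately show ?thesis
        unfolding B_def by (subst pos_divide_le_eq) (simp_all add: algebra_simps)
    qed
    finally show ?thesis .
  qed
  \<comment> \<open>Markov's inequality: at most \<open>B / R\<close> of the mass lies outside a
    finite set that does not depend on \<open>n\<close>.\<close>
  have tight: "(\<Sum>y\<in>{y. f y \<le> R}. pmf (\<nu> n) y) \<ge> 1 - B / R" if "R > 0" for n R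
  proof -
    have ind: "indicat_real (- {y. f y \<le> R}) y \<le> f y / R" for y
      using f(1)[of y] that by (auto split: split_indicator)
    have "measure (measure_pmf (\<nu> n)) (- {y. f y \<le> R}) =
        (\<integral>y. indicat_real (- {y. f y \<le> R}) y \<partial>measure_pmf (\<nu> n))"
      by simp
    also have "\<dots> \<le> (\<integral>y. f y / R \<partial>measure_pmf (\<nu> n))"
      by (intro integral_mono int ind)
    also have "\<dots> \<le> B / R"
      using Ef[of n] that by (simp add: divide_right_mono)
    finally show ?thesis
      using measure_pmf.prob_compl[of "{y. f y \<le> R}" "\<nu> n"]
      by (simp add: Compl_eq_Diff_UNIV measure_measure_pmf_finite f(2))
  qed
  \<comment> \<open>Diagonal selection over the countable state space; all the values lie in
    \<open>[0, 1]\<close>.\<close>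
  obtain k where k: "strict_mono k" and conv: "\<And>y. \<exists>l. (\<lambda>n. pmf (\<nu> (k n)) y) \<longlonglongrightarrow> l"
    by (rule function_convergent_subsequence[of "UNIV :: 's set" "\<lambda>n y. pmf (\<nu> n) y" 1])
       (auto simp: pmf_le_1)
  define l where "l y = lim (\<lambda>n. pmf (\<nu> (k n)) y)" for y
  have l: "(\<lambda>n. pmf (\<nu> (k n)) y) \<longlonglongrightarrow> l y" for y
    using conv[of y] unfolding l_def by (auto simp: convergent_def[symmetric] convergent_LIMSEQ_iff)
  have l_nonneg: "l y \<ge> 0" for y
    by (rule LIMSEQ_le_const[OF l]) auto
  have l_le: "sum l F \<le> 1" if "finite F" for F
  proof (rule LIMSEQ_le_const2)
    show "(\<lambda>n. \<Sum>y\<in>F. pmf (\<nu> (k n)) y) \<longlonglongrightarrow> sum l F"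
      by (intro tendsto_sum l)
    show "\<exists>N. \<forall>n\<ge>N. (\<Sum>y\<in>F. pmf (\<nu> (k n)) y) \<le> 1"
      using that by (simp flip: measure_measure_pmf_finite)
  qed
  have l_ge: "(\<Sum>y\<in>{y. f y \<le> R}. l y) \<ge> 1 - B / R" if "R > 0" for R
  proof (rule LIMSEQ_le_const)
    show "(\<lambda>n. \<Sum>y\<in>{y. f y \<le> R}. pmf (\<nu> (k n)) y) \<longlonglongrightarrow> (\<Sum>y\<in>{y. f y \<le> R}. l y)"
      by (intro tendsto_sum l)
  qed (use tight[OF that] in auto)
  have summable: "l summable_on UNIV"
    by (rule nonneg_bdd_above_summable_on) (auto simp: l_nonneg l_le intro!: bdd_aboveI2[where M = 1])
  have total: "(\<Sum>\<^sub>\<infinity>y. l y) = 1"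
  proof (rule antisym)
    show "(\<Sum>\<^sub>\<infinity>y. l y) \<le> 1"
      by (rule infsum_le_finite_sums[OF summable]) (auto simp: l_le)
    \<comment> \<open>Tightness rules out escape of mass to infinity: the bound holds for every
      \<open>R > 0\<close>, and \<open>R\<close> may be sent to infinity.\<close>
    have "1 - B / R \<le> (\<Sum>\<^sub>\<infinity>y. l y)" if "R > 0" for R
      by (rule order_trans[OF l_ge[OF that]])
         (rule finite_sum_le_infsum[OF summable], auto simp: f l_nonneg)
    then have "\<forall>\<^sub>F R in at_top. 1 - B / R \<le> (\<Sum>\<^sub>\<infinity>y. l y)"
      by (auto intro: eventually_at_top_linorderI[of 1])
    moreover have "((\<lambda>R. 1 - B / R) \<longlongrightarrow> 1) at_top"
      by real_asymp
    ultimately show "1 \<le> (\<Sum>\<^sub>\<infinity>y. l y)"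
      by (intro tendsto_upperbound) auto
  qed
  have "(\<integral>\<^sup>+y. ennreal (l y) \<partial>count_space UNIV) = 1"
  proof -
    have "(\<lambda>y. norm (l y)) = l"
      by (auto simp: l_nonneg)
    with summable have abs: "Infinite_Set_Sum.abs_summable_on l UNIV"
      by (simp only: abs_summable_equivalent[symmetric])
    then have "(\<integral>\<^sup>+y. ennreal (l y) \<partial>count_space UNIV) = ennreal (infsetsum l UNIV)"
      by (rule nn_integral_conv_infsetsum) (rule l_nonneg)
    with total abs show ?thesis
      by (simp add: infsetsum_infsum)
  qed
  then obtain \<pi> where \<pi>: "\<And>y. pmf \<pi> y = l y"
    using pmf_embed_pmf[of l] l_nonneg by metis
  \<comment> \<open>Only this inequality is sought: finite parts of the sum over the previous state
    pass to the limit, the whole sum need not do so without further argument.\<close>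
  have "pmf (bind_pmf \<pi> K) y \<le> pmf \<pi> y" for y
  proof -
    \<comment> \<open>Shifting the time window by one trades the law at time \<open>0\<close> for
      the law at time \<open>n + 1\<close>, at a cost of at most one of the \<open>n + 1\<close>
      terms.\<close>
    have almost: "pmf (bind_pmf (\<nu> n) K) y \<le> pmf (\<nu> n) y + 1 / real (Suc n)" for n
    proof -
      have "bind_pmf (\<nu> n) K = bind_pmf (pmf_of_set {..n}) (\<lambda>k. ?law (Suc k))"
        by (simp add: \<nu>_def bind_assoc_pmf)
      then have "pmf (bind_pmf (\<nu> n) K) y = (\<Sum>k\<le>n. pmf (?law (Suc k)) y) / real (Suc n)"
        by (subst (asm) pmf_eq_iff) (simp add: pmf_bind_pmf_of_set del: iterate_kernel.simps)
      moreover have "(\<Sum>k\<le>n. pmf (?law (Suc k)) y) \<le> (\<Sum>k\<le>n. pmf (?law k) y) + 1"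
      proof -
        have "(\<Sum>k\<le>n. pmf (?law (Suc k)) y) + pmf (?law 0) y = (\<Sum>k\<le>Suc n. pmf (?law k) y)"
          by (subst sum.atMost_Suc_shift) simp
        also have "\<dots> = (\<Sum>k\<le>n. pmf (?law k) y) + pmf (?law (Suc n)) y"
          by simp
        finally show ?thesis
          using pmf_le_1[of "?law (Suc n)" y] pmf_nonneg[of "?law 0" y] by linarith
      qed
      ultimately have "pmf (bind_pmf (\<nu> n) K) y \<le> ((\<Sum>k\<le>n. pmf (?law k) y) + 1) / real (Suc n)"
        by (simp add: divide_right_mono)
      also have "\<dots> = pmf (\<nu> n) y + 1 / real (Suc n)"
        by (simp add: \<nu>_def pmf_bind_pmf_of_set add_divide_distrib)
      finally show ?thesis .
    qed
    have part: "(\<Sum>x\<in>F. pmf (K x) y * l x) \<le> l y" if F: "finite F" for F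
    proof (rule LIMSEQ_le)
      show "(\<lambda>n. \<Sum>x\<in>F. pmf (K x) y * pmf (\<nu> (k n)) x) \<longlonglongrightarrow> (\<Sum>x\<in>F. pmf (K x) y * l x)"
        by (intro tendsto_sum tendsto_mult l tendsto_const)
      have "(\<lambda>n. pmf (\<nu> (k n)) y + 1 / real (Suc (k n))) \<longlonglongrightarrow> l y + 0"
        using LIMSEQ_subseq_LIMSEQ[OF LIMSEQ_Suc[OF lim_1_over_n] k]
        by (intro tendsto_add l) (simp add: o_def)
      then show "(\<lambda>n. pmf (\<nu> (k n)) y + 1 / real (Suc (k n))) \<longlonglongrightarrow> l y" by simp
      have "(\<Sum>x\<in>F. pmf (K x) y * pmf (\<nu> m) x) \<le> pmf (\<nu> m) y + 1 / real (Suc m)" for m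
      proof -
        have "(\<Sum>x\<in>F. pmf (K x) y * pmf (\<nu> m) x) \<le>
            (\<Sum>x\<in>F \<union> set_pmf (\<nu> m). pmf (K x) y * pmf (\<nu> m) x)"
          using F by (intro sum_mono2) (auto simp: fin_\<nu>)
        also have "\<dots> = pmf (bind_pmf (\<nu> m) K) y"
          unfolding pmf_bind using F
          by (intro integral_measure_pmf_real[symmetric]) (auto simp: fin_\<nu>)
        finally show ?thesis using almost[of m] by simp
      qed
      then show "\<exists>N. \<forall>n\<ge>N. (\<Sum>x\<in>F. pmf (K x) y * pmf (\<nu> (k n)) x) \<le>
          pmf (\<nu> (k n)) y + 1 / real (Suc (k n))" by blast
    qed
    have abs: "(\<lambda>x. pmf \<pi> x * pmf (K x) y) summable_on UNIV"
      by (rule nonneg_bdd_above_summable_on)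
         (use part in \<open>auto simp: \<pi> l_nonneg mult.commute intro!: bdd_aboveI2[where M = "l y"]\<close>)
    have "pmf (bind_pmf \<pi> K) y = infsetsum (\<lambda>x. pmf \<pi> x * pmf (K x) y) UNIV"
      unfolding pmf_bind by (rule pmf_expectation_eq_infsetsum)
    also have "\<dots> = (\<Sum>\<^sub>\<infinity>x. pmf \<pi> x * pmf (K x) y)"
      using abs by (intro infsetsum_infsum) (simp add: abs_summable_equivalent[symmetric])
    also have "\<dots> \<le> l y"
      by (rule infsum_le_finite_sums[OF abs]) (use part in \<open>simp add: \<pi> mult.commute\<close>)
    finally show ?thesis by (simp add: \<pi>)
  qed
  then show ?thesis
    using pmf_le_imp_eq by blast
qed

subsection \<open>Balance of probability flows in equilibrium\<close>

text \<open>Being at \<open>x\<close> both after \<open>n\<close> steps of length \<open>t\<close>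
  and after the next one is one way to be there at the end. So the return probabilities are
  supermultiplicative, and \<open>1 - a * b\<close> is at most \<open>(1 - a) + (1 - b)\<close> for
  \<open>a\<close> and \<open>b\<close> in \<open>[0, 1]\<close>.\<close>

lemma one_minus_return_le:
  assumes P: "markov_chain_with_rates q P" and t: "t \<ge> 0"
  shows "1 - pmf (P (real n * t) x) x \<le> real n * (1 - pmf (P t x) x)"
proof (induction n)
  case 0
  show ?case using P by (simp add: markov_chain_with_rates_def)
next
  case (Suc n)
  let ?a = "pmf (P (real n * t) x) x" and ?b = "pmf (P t x) x"
  have "P (real n * t + t) x = bind_pmf (P (real n * t) x) (P t)"
    using P t by (simp add: markov_chain_with_rates_def)
  then have "pmf (P (real (Suc n) * t) x) x = (\<integral>y. pmf (P t y) x \<partial>measure_pmf (P (real n * t) x))"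
    by (simp add: algebra_simps pmf_bind)
  also have "\<dots> \<ge> (\<integral>y. ?b * indicat_real {x} y \<partial>measure_pmf (P (real n * t) x))"
    by (intro integral_mono integrable_measure_pmf_bounded[where B = 1])
       (auto simp: pmf_le_1 split: split_indicator)
  finally have ge: "?b * ?a \<le> pmf (P (real (Suc n) * t) x) x"
    by (simp add: measure_pmf_single)
  have "0 \<le> (1 - ?a) * (1 - ?b)"
    by (simp add: pmf_le_1)
  with ge Suc show ?case by (simp add: algebra_simps)
qed

text \<open>Splitting \<open>[0, t]\<close> into ever shorter intervals turns the rate condition at \<open>0\<close> into a bound
  for every \<open>t\<close>; it is uniform in \<open>x\<close> when the total rates are bounded.\<close>

lemma leave_probability_le:
  assumes P: "markov_chain_with_rates q P" and t: "t > 0"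
  shows "1 - pmf (P t x) x \<le> t * (\<Sum>\<^sub>\<infinity>y\<in>- {x}. q x y)"
proof -
  let ?h = "\<lambda>s. (1 - pmf (P s x) x) / s"
  have "(?h \<longlongrightarrow> (\<Sum>\<^sub>\<infinity>y\<in>- {x}. q x y)) (at_right 0)"
    using P by (simp add: markov_chain_with_rates_def)
  moreover have "filterlim (\<lambda>n. t / real (Suc n)) (at_right 0) sequentially"
    using t by real_asymp
  ultimately have "(\<lambda>n. ?h (t / real (Suc n))) \<longlonglongrightarrow> (\<Sum>\<^sub>\<infinity>y\<in>- {x}. q x y)"
    by (rule filterlim_compose)
  moreover have "?h t \<le> ?h (t / real (Suc n))" for n
    using one_minus_return_le[OF P, of "t / real (Suc n)" "Suc n" x] t
    by (simp add: divide_simps mult.commute del: of_nat_Suc)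
  ultimately have "?h t \<le> (\<Sum>\<^sub>\<infinity>y\<in>- {x}. q x y)"
    by (intro LIMSEQ_le_const) auto
  with t show ?thesis
    by (simp add: field_simps)
qed

text \<open>Limits at single states do not control an infinite set \<open>A\<close> by themselves.
  The condition on the total rate does: the finitely many states with nonzero rate exhaust it, so
  the probability of having moved anywhere else is \<open>o(t)\<close>.\<close>

lemma transition_limit:
  assumes P: "markov_chain_with_rates q P"
    and fin: "finite {y. y \<noteq> x \<and> q x y \<noteq> 0}" and x: "x \<notin> A"
  shows "((\<lambda>t. measure (measure_pmf (P t x)) A / t) \<longlongrightarrow> (\<Sum>\<^sub>\<infinity>y\<in>A. q x y)) (at_right 0)"
proof -
  define N where "N = {y. y \<noteq> x \<and> q x y \<noteq> 0}"
  have [simp]: "finite N" using fin by (simp add: N_def)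
  have infsum: "(\<Sum>\<^sub>\<infinity>y\<in>B. q x y) = (\<Sum>y\<in>B \<inter> N. q x y)" if "x \<notin> B" for B
  proof -
    have "(q x has_sum (\<Sum>y\<in>B \<inter> N. q x y)) B"
      by (rule has_sum_finite_neutralI[where B = "B \<inter> N"]) (use that fin in \<open>auto simp: N_def\<close>)
    then show ?thesis by (rule infsumI)
  qed
  have pt: "((\<lambda>t. pmf (P t x) y / t) \<longlongrightarrow> q x y) (at_right 0)" if "y \<in> N" for y
    using P that by (simp add: markov_chain_with_rates_def N_def)
  have low: "((\<lambda>t. (\<Sum>y\<in>B \<inter> N. pmf (P t x) y / t)) \<longlongrightarrow> (\<Sum>\<^sub>\<infinity>y\<in>B. q x y)) (at_right 0)"
    if "x \<notin> B" for B
    unfolding infsum[OF that] by (intro tendsto_sum pt) simp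
  have total: "((\<lambda>t. (1 - pmf (P t x) x) / t) \<longlongrightarrow> (\<Sum>\<^sub>\<infinity>y\<in>- {x}. q x y)) (at_right 0)"
    using P by (simp add: markov_chain_with_rates_def)
  \<comment> \<open>Upper bound for the sandwich: mass of \<open>A\<close> outside \<open>N\<close>
    is at most the leaving probability that \<open>N\<close> does not account for.\<close>
  have rest: "((\<lambda>t. (1 - pmf (P t x) x) / t - (\<Sum>y\<in>- {x} \<inter> N. pmf (P t x) y / t) +
      (\<Sum>y\<in>A \<inter> N. pmf (P t x) y / t)) \<longlongrightarrow> (\<Sum>\<^sub>\<infinity>y\<in>A. q x y)) (at_right 0)"
    using tendsto_add[OF tendsto_diff[OF total low] low, of "- {x}" A] x by simp
  have sum_measure: "(\<Sum>y\<in>F. pmf M y / t) = measure (measure_pmf M) F / t" if "finite F" for F M t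
    using that by (simp add: measure_measure_pmf_finite sum_divide_distrib)
  have upper: "measure (measure_pmf M) A \<le>
      1 - pmf M x - measure (measure_pmf M) (- {x} \<inter> N) + measure (measure_pmf M) (A \<inter> N)" for M
  proof -
    have "measure (measure_pmf M) A = measure (measure_pmf M) (A - N) + measure (measure_pmf M) (A \<inter> N)"
      by (subst measure_pmf.finite_measure_Union[symmetric]) (auto intro: arg_cong2[where f = measure])
    moreover have "measure (measure_pmf M) (A - N) + measure (measure_pmf M) (- {x} \<inter> N)
        = measure (measure_pmf M) ((A - N) \<union> (- {x} \<inter> N))"
      by (subst measure_pmf.finite_measure_Union) auto
    moreover have "\<dots> \<le> measure (measure_pmf M) (- {x})"
      using x by (intro measure_pmf.finite_measure_mono) auto
    moreover have "measure (measure_pmf M) (- {x}) = 1 - pmf M x"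
      using measure_pmf.prob_compl[of "{x}" M] by (simp add: measure_pmf_single Compl_eq_Diff_UNIV)
    ultimately show ?thesis by linarith
  qed
  show ?thesis
  proof (rule tendsto_sandwich[OF _ _ low[OF x] rest])
    show "\<forall>\<^sub>F t in at_right 0. (\<Sum>y\<in>A \<inter> N. pmf (P t x) y / t) \<le> measure (measure_pmf (P t x)) A / t"
      by (rule eventually_at_rightI[of 0 1])
         (auto simp: sum_measure intro!: divide_right_mono measure_pmf.finite_measure_mono)
    show "\<forall>\<^sub>F t in at_right 0. measure (measure_pmf (P t x)) A / t \<le>
        (1 - pmf (P t x) x) / t - (\<Sum>y\<in>- {x} \<inter> N. pmf (P t x) y / t) + (\<Sum>y\<in>A \<inter> N. pmf (P t x) y / t)"
      by (rule eventually_at_rightI[of 0 1])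
         (use upper in \<open>auto simp: sum_measure add_divide_distrib[symmetric]
           diff_divide_distrib[symmetric] intro!: divide_right_mono\<close>)
  qed
qed

text \<open>Going from \<open>A\<close> to \<open>B\<close> requires leaving the initial state,
  because the sets are disjoint. The bound on leaving probabilities therefore dominates the
  difference quotients by \<open>C\<close>, and dominated convergence moves the limit under the
  integral.\<close>

lemma stationary_flow_limit:
  assumes P: "markov_chain_with_rates q P"
    and fin: "\<And>x. finite {y. y \<noteq> x \<and> q x y \<noteq> 0}"
    and bound: "\<And>x. (\<Sum>\<^sub>\<infinity>y\<in>- {x}. q x y) \<le> C"
    and disj: "A \<inter> B = {}"
  shows "(\<lambda>n. (\<integral>x. indicat_real A x * measure (measure_pmf (P (1 / real (Suc n)) x)) B \<partial>measure_pmf \<pi>)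
             * real (Suc n)) \<longlonglongrightarrow>
         (\<integral>x. indicat_real A x * (\<Sum>\<^sub>\<infinity>y\<in>B. q x y) \<partial>measure_pmf \<pi>)"
proof -
  let ?h = "\<lambda>n x. indicat_real A x * (measure (measure_pmf (P (1 / real (Suc n)) x)) B * real (Suc n))"
  \<comment> \<open>Needed for the dominating constant at states outside \<open>A\<close>, where the
    integrand is \<open>0\<close>.\<close>
  have C: "C \<ge> 0"
  proof -
    obtain x :: 'a where True by simp
    have "0 \<le> 1 - pmf (P 1 x) x" by (simp add: pmf_le_1)
    also have "\<dots> \<le> 1 * (\<Sum>\<^sub>\<infinity>y\<in>- {x}. q x y)"
      by (rule leave_probability_le[OF P]) simp
    finally show ?thesis using bound[of x] by simp
  qed
  have "(\<lambda>n. \<integral>x. ?h n x \<partial>measure_pmf \<pi>) \<longlonglongrightarrow>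
      (\<integral>x. indicat_real A x * (\<Sum>\<^sub>\<infinity>y\<in>B. q x y) \<partial>measure_pmf \<pi>)"
  proof (rule integral_dominated_convergence[where w = "\<lambda>_. C"])
    show "AE x in measure_pmf \<pi>. (\<lambda>n. ?h n x) \<longlonglongrightarrow> indicat_real A x * (\<Sum>\<^sub>\<infinity>y\<in>B. q x y)"
    proof (rule AE_I2)
      fix x
      show "(\<lambda>n. ?h n x) \<longlonglongrightarrow> indicat_real A x * (\<Sum>\<^sub>\<infinity>y\<in>B. q x y)"
      proof (cases "x \<in> A")
        case True
        with disj have "x \<notin> B" by auto
        from transition_limit[OF P fin this]
        have "(\<lambda>n. measure (measure_pmf (P (1 / real (Suc n)) x)) B / (1 / real (Suc n))) \<longlonglongrightarrow>
            (\<Sum>\<^sub>\<infinity>y\<in>B. q x y)"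
          by (rule filterlim_compose) real_asymp
        with True show ?thesis by simp
      qed simp
    qed
    fix n
    show "AE x in measure_pmf \<pi>. norm (?h n x) \<le> C"
    proof (rule AE_I2)
      fix x
      show "norm (?h n x) \<le> C"
      proof (cases "x \<in> A")
        case True
        with disj have "measure (measure_pmf (P (1 / real (Suc n)) x)) B \<le>
            measure (measure_pmf (P (1 / real (Suc n)) x)) (- {x})"
          by (intro measure_pmf.finite_measure_mono) auto
        also have "\<dots> = 1 - pmf (P (1 / real (Suc n)) x) x"
          using measure_pmf.prob_compl[of "{x}" "P (1 / real (Suc n)) x"]
          by (simp add: measure_pmf_single Compl_eq_Diff_UNIV)
        also have "\<dots> \<le> 1 / real (Suc n) * (\<Sum>\<^sub>\<infinity>y\<in>- {x}. q x y)"
          by (rule leave_probability_le[OF P]) simp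
        also have "\<dots> \<le> 1 / real (Suc n) * C"
          by (intro mult_left_mono bound) simp
        finally show ?thesis
          using True by (simp add: field_simps del: of_nat_Suc)
      qed (simp add: C)
    qed
  qed auto
  then show ?thesis
    by (simp only: mult.assoc[symmetric] Bochner_Integration.integral_mult_left_zero)
qed

text \<open>In equilibrium the probability of \<open>A\<close> is the same at times \<open>0\<close>
  and \<open>t\<close>, so exits from \<open>A\<close> and entries into \<open>A\<close> over that
  time are equally likely. Dividing by \<open>t\<close> and letting \<open>t\<close> tend to
  \<open>0\<close> equates the two flows.\<close>

lemma stationary_balance:
  assumes P: "markov_chain_with_rates q P" and \<pi>: "stationary_distribution P \<pi>"
    and fin: "\<And>x. finite {y. y \<noteq> x \<and> q x y \<noteq> 0}"
    and bound: "\<And>x. (\<Sum>\<^sub>\<infinity>y\<in>- {x}. q x y) \<le> C"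
  shows "(\<integral>x. indicat_real A x * (\<Sum>\<^sub>\<infinity>y\<in>- A. q x y) \<partial>measure_pmf \<pi>) =
         (\<integral>x. indicat_real (- A) x * (\<Sum>\<^sub>\<infinity>y\<in>A. q x y) \<partial>measure_pmf \<pi>)"
proof -
  have eq: "(\<integral>x. indicat_real A x * measure (measure_pmf (P t x)) (- A) \<partial>measure_pmf \<pi>) =
      (\<integral>x. indicat_real (- A) x * measure (measure_pmf (P t x)) A \<partial>measure_pmf \<pi>)" if "t \<ge> 0" for t
  proof -
    have compl: "measure (measure_pmf M) (- A) = 1 - measure (measure_pmf M) A" for M
      using measure_pmf.prob_compl[of A M] by (simp add: Compl_eq_Diff_UNIV)
    have int: "integrable (measure_pmf \<pi>) (\<lambda>x. indicat_real B x * measure (measure_pmf (P t x)) B')"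
      "integrable (measure_pmf \<pi>) (indicat_real B)" for B B'
      by (auto intro!: integrable_measure_pmf_bounded[where B = 1] split: split_indicator)
    have "measure (measure_pmf \<pi>) A = measure (measure_pmf (bind_pmf \<pi> (P t))) A"
      using \<pi> that by (simp add: stationary_distribution_def)
    also have "\<dots> = (\<integral>x. indicat_real A x * measure (measure_pmf (P t x)) A +
        indicat_real (- A) x * measure (measure_pmf (P t x)) A \<partial>measure_pmf \<pi>)"
      unfolding measure_bind_pmf by (intro Bochner_Integration.integral_cong) (auto split: split_indicator)
    also have "\<dots> = (\<integral>x. indicat_real A x * measure (measure_pmf (P t x)) A \<partial>measure_pmf \<pi>) +
        (\<integral>x. indicat_real (- A) x * measure (measure_pmf (P t x)) A \<partial>measure_pmf \<pi>)"
      by (intro Bochner_Integration.integral_add int)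
    finally have "(\<integral>x. indicat_real (- A) x * measure (measure_pmf (P t x)) A \<partial>measure_pmf \<pi>) =
        (\<integral>x. indicat_real A x \<partial>measure_pmf \<pi>) -
        (\<integral>x. indicat_real A x * measure (measure_pmf (P t x)) A \<partial>measure_pmf \<pi>)"
      by simp
    also have "\<dots> = (\<integral>x. indicat_real A x * measure (measure_pmf (P t x)) (- A) \<partial>measure_pmf \<pi>)"
      unfolding compl right_diff_distrib mult_1_right
      by (intro Bochner_Integration.integral_diff[symmetric] int)
    finally show ?thesis by simp
  qed
  have "(\<lambda>n. (\<integral>x. indicat_real A x * measure (measure_pmf (P (1 / real (Suc n)) x)) (- A) \<partial>measure_pmf \<pi>)
      * real (Suc n)) \<longlonglongrightarrow> (\<integral>x. indicat_real (- A) x * (\<Sum>\<^sub>\<infinity>y\<in>A. q x y) \<partial>measure_pmf \<pi>)"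
    using stationary_flow_limit[OF P fin bound, of "- A" A] by (simp add: eq)
  moreover have "(\<lambda>n. (\<integral>x. indicat_real A x * measure (measure_pmf (P (1 / real (Suc n)) x)) (- A) \<partial>measure_pmf \<pi>)
      * real (Suc n)) \<longlonglongrightarrow> (\<integral>x. indicat_real A x * (\<Sum>\<^sub>\<infinity>y\<in>- A. q x y) \<partial>measure_pmf \<pi>)"
    using stationary_flow_limit[OF P fin bound, of A "- A"] by simp
  ultimately show ?thesis
    by (rule LIMSEQ_unique[symmetric])
qed

subsection \<open>Queueing networks\<close>

lemma sum_Collect_eq:
  fixes g :: "'v::finite \<Rightarrow> real"
  shows "(\<Sum>v | Q v. g v) = (\<Sum>v\<in>UNIV. if Q v then g v else 0)"
  by (simp add: sum.If_cases)

text \<open>Converts a sum over target states into a sum over the vertices whose jump lands in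
  \<open>A\<close>; total rates and flows across cuts are read off from it.\<close>

lemma has_sum_queue_rates:
  fixes x :: "'v::finite \<Rightarrow> nat"
  shows "(queue_rates a mu x has_sum
     ((\<Sum>v | x(v := x v + 1) \<in> A. a x v) + (\<Sum>v | x v > 0 \<and> x(v := x v - 1) \<in> A. mu v))) A"
proof -
  define N where "N = range (\<lambda>v. x(v := x v + 1)) \<union> range (\<lambda>v. x(v := x v - 1))"
  have fin: "finite N" by (simp add: N_def)
  \<comment> \<open>Each vertex has a single target \<open>s v\<close>, so after exchanging the sums
    the inner one has at most one nonzero term. Used once for arrivals and once for
    services.\<close>
  have swap: "(\<Sum>y\<in>A \<inter> N. \<Sum>v | Q v \<and> y = s v. g v) = (\<Sum>v | Q v \<and> s v \<in> A. g v)"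
    if "\<And>v. Q v \<Longrightarrow> s v \<in> N" for s :: "'v \<Rightarrow> 'v \<Rightarrow> nat" and Q :: "'v \<Rightarrow> bool" and g :: "'v \<Rightarrow> real"
  proof -
    have "(\<Sum>y\<in>A \<inter> N. \<Sum>v | Q v \<and> y = s v. g v) =
        (\<Sum>y\<in>A \<inter> N. \<Sum>v\<in>UNIV. if y = s v then if Q v then g v else 0 else 0)"
      by (intro sum.cong refl trans[OF sum_Collect_eq]) auto
    also have "\<dots> = (\<Sum>v\<in>UNIV. \<Sum>y\<in>A \<inter> N. if y = s v then if Q v then g v else 0 else 0)"
      by (rule sum.swap)
    also have "\<dots> = (\<Sum>v\<in>UNIV. if Q v \<and> s v \<in> A then g v else 0)"
      using fin that by (intro sum.cong refl) (auto simp: sum.delta)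
    also have "\<dots> = (\<Sum>v | Q v \<and> s v \<in> A. g v)"
      by (simp add: sum.If_cases)
    finally show ?thesis .
  qed
  show ?thesis
  proof (rule has_sum_finite_neutralI[where B = "A \<inter> N"])
    show "queue_rates a mu x y = 0" if "y \<in> A - A \<inter> N" for y
    proof -
      from that have "{v. y = x(v := x v + 1)} = {}" "{v. x v > 0 \<and> y = x(v := x v - 1)} = {}"
        by (auto simp: N_def)
      then show ?thesis by (simp only: queue_rates_def sum.empty add_0)
    qed
    show "(\<Sum>v | x(v := x v + 1) \<in> A. a x v) + (\<Sum>v | x v > 0 \<and> x(v := x v - 1) \<in> A. mu v) =
        (\<Sum>y\<in>A \<inter> N. queue_rates a mu x y)"
      using swap[of "\<lambda>_. True" "\<lambda>v. x(v := x v + 1)" "a x"]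
        swap[of "\<lambda>v. x v > 0" "\<lambda>v. x(v := x v - 1)" mu]
      by (auto simp: queue_rates_def sum.distrib N_def)
  qed (use fin in auto)
qed

lemmas infsum_queue_rates = has_sum_queue_rates[THEN infsumI]

lemma finite_queue_rates_support:
  fixes x :: "'v::finite \<Rightarrow> nat"
  shows "finite {y. y \<noteq> x \<and> queue_rates a mu x y \<noteq> 0}"
proof (rule finite_subset)
  show "{y. y \<noteq> x \<and> queue_rates a mu x y \<noteq> 0} \<subseteq>
      range (\<lambda>v. x(v := x v + 1)) \<union> range (\<lambda>v. x(v := x v - 1))"
  proof (rule subsetI, rule ccontr)
    fix y assume "y \<in> {y. y \<noteq> x \<and> queue_rates a mu x y \<noteq> 0}"
      and "y \<notin> range (\<lambda>v. x(v := x v + 1)) \<union> range (\<lambda>v. x(v := x v - 1))"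
    then have "queue_rates a mu x y \<noteq> 0"
      and "{v. y = x(v := x v + 1)} = {}" "{v. x v > 0 \<and> y = x(v := x v - 1)} = {}"
      by auto
    then show False by (simp only: queue_rates_def sum.empty add_0)
  qed
qed simp

section \<open>The uniformized jump chain of a queueing network and its drift\<close>

lemma sum_option_sum:
  fixes g :: "('v::finite + 'w::finite) option \<Rightarrow> real"
  shows "(\<Sum>j\<in>UNIV. g j) = g None + (\<Sum>v\<in>UNIV. g (Some (Inl v))) + (\<Sum>v\<in>UNIV. g (Some (Inr v)))"
proof -
  have "(\<Sum>j\<in>UNIV. g j) = g None + (\<Sum>j\<in>UNIV. g (Some j))"
    by (simp add: UNIV_option_conv sum.reindex)
  also have "(\<Sum>j\<in>UNIV. g (Some j)) = (\<Sum>v\<in>UNIV. g (Some (Inl v))) + (\<Sum>v\<in>UNIV. g (Some (Inr v)))"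
    by (simp add: UNIV_Plus_UNIV[symmetric] sum.Plus o_def del: UNIV_Plus_UNIV)
  finally show ?thesis by simp
qed

text \<open>The jumps of the uniformized chain: an arrival at a vertex (\<open>Inl\<close>), a possibly void
  service completion (\<open>Inr\<close>), or no change.\<close>

primrec queue_jump :: "('v \<Rightarrow> nat) \<Rightarrow> ('v + 'v) option \<Rightarrow> 'v \<Rightarrow> nat" where
  "queue_jump x None = x"
| "queue_jump x (Some j) = (case j of Inl v \<Rightarrow> x(v := x v + 1) | Inr v \<Rightarrow> x(v := x v - 1))"

text \<open>Rates divided by \<open>L\<close> become jump probabilities, and \<open>None\<close>
  takes the remaining mass. Truncated subtraction makes a service at an empty vertex leave the state
  unchanged, so it contributes neither to a transition with \<open>y \<noteq> x\<close> nor to the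
  generator formula, which can run over all vertices.\<close>

lemma ex_queue_kernel:
  fixes a :: "('v::finite \<Rightarrow> nat) \<Rightarrow> 'v \<Rightarrow> real"
  assumes a: "\<And>x v. a x v \<ge> 0" and mu: "\<And>v. mu v \<ge> 0"
    and L: "L > 0" "\<And>x. (\<Sum>v\<in>UNIV. a x v) + (\<Sum>v\<in>UNIV. mu v) \<le> L"
  obtains K where "\<And>x. finite (set_pmf (K x))"
    and "\<And>x y. y \<noteq> x \<Longrightarrow> queue_rates a mu x y = L * pmf (K x) y"
    and "\<And>x (h :: ('v \<Rightarrow> nat) \<Rightarrow> real). L * ((\<integral>y. h y \<partial>measure_pmf (K x)) - h x) =
      (\<Sum>v\<in>UNIV. a x v * (h (x(v := x v + 1)) - h x)) +
      (\<Sum>v\<in>UNIV. mu v * (h (x(v := x v - 1)) - h x))"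
proof -
  define w where "w x j = (case j of None \<Rightarrow> 1 - ((\<Sum>v\<in>UNIV. a x v) + (\<Sum>v\<in>UNIV. mu v)) / L
      | Some (Inl v) \<Rightarrow> a x v / L | Some (Inr v) \<Rightarrow> mu v / L)" for x and j :: "('v + 'v) option"
  have w_nonneg: "w x j \<ge> 0" for x j
    using a mu L by (auto simp: w_def divide_simps split: option.split sum.split)
  have w_sum: "(\<Sum>j\<in>UNIV. w x j) = 1" for x
    by (simp add: sum_option_sum w_def sum_divide_distrib[symmetric] add_divide_distrib)
  have "(\<integral>\<^sup>+j. ennreal (w x j) \<partial>count_space UNIV) = 1" for x
    by (simp add: nn_integral_count_space_finite w_nonneg w_sum sum_ennreal)
  then have "\<exists>D. \<forall>j. pmf D j = w x j" for x
    using pmf_embed_pmf[of "w x"] w_nonneg by blast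
  then obtain D where D: "\<And>x j. pmf (D x) j = w x j"
    by metis
  define K where "K x = map_pmf (queue_jump x) (D x)" for x
  show thesis
  proof (rule that)
    show "finite (set_pmf (K x))" for x
      by (simp add: K_def)
    show "queue_rates a mu x y = L * pmf (K x) y" if "y \<noteq> x" for x y
    proof -
      have "L * pmf (K x) y = L * (\<Sum>j\<in>UNIV. if y = queue_jump x j then w x j else 0)"
        by (simp add: K_def pmf_map measure_measure_pmf_finite D sum.If_cases vimage_def eq_commute)
      also have "\<dots> = (\<Sum>v\<in>UNIV. if y = x(v := x v + 1) then a x v else 0) +
          (\<Sum>v\<in>UNIV. if y = x(v := x v - 1) then mu v else 0)"
        using that L(1)
        by (simp add: sum_option_sum w_def sum_distrib_left distrib_left if_distrib[of "\<lambda>c. L * c"]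
            cong: if_cong)
      \<comment> \<open>For \<open>x v = 0\<close> the target would be \<open>x\<close> itself,
        which \<open>y \<noteq> x\<close> excludes.\<close>
      also have "(\<Sum>v\<in>UNIV. if y = x(v := x v - 1) then mu v else 0) =
          (\<Sum>v\<in>UNIV. if x v > 0 \<and> y = x(v := x v - 1) then mu v else 0)"
        by (intro sum.cong refl) (use that in auto)
      finally show ?thesis
        by (simp only: queue_rates_def sum_Collect_eq)
    qed
    show "L * ((\<integral>y. h y \<partial>measure_pmf (K x)) - h x) =
      (\<Sum>v\<in>UNIV. a x v * (h (x(v := x v + 1)) - h x)) +
      (\<Sum>v\<in>UNIV. mu v * (h (x(v := x v - 1)) - h x))" for x and h :: "('v \<Rightarrow> nat) \<Rightarrow> real"
    proof -
      have "(\<integral>y. h y \<partial>measure_pmf (K x)) = (\<Sum>j\<in>UNIV. w x j * h (queue_jump x j))"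
        unfolding K_def by (simp add: integral_measure_pmf[of UNIV] D)
      moreover have "(\<Sum>j\<in>UNIV. w x j * (h (queue_jump x j) - h x)) =
          (\<Sum>j\<in>UNIV. w x j * h (queue_jump x j)) - h x"
        by (simp add: right_diff_distrib sum_subtractf sum_distrib_right[symmetric] w_sum)
      ultimately have "L * ((\<integral>y. h y \<partial>measure_pmf (K x)) - h x) =
          L * (\<Sum>j\<in>UNIV. w x j * (h (queue_jump x j) - h x))"
        by simp
      also have "\<dots> = (\<Sum>j\<in>UNIV. L * w x j * (h (queue_jump x j) - h x))"
        by (simp add: sum_distrib_left mult.assoc)
      also have "\<dots> = (\<Sum>v\<in>UNIV. a x v * (h (x(v := x v + 1)) - h x)) +
          (\<Sum>v\<in>UNIV. mu v * (h (x(v := x v - 1)) - h x))"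
        using L(1) by (simp add: sum_option_sum w_def)
      finally show ?thesis .
    qed
  qed
qed

text \<open>The sum of squared queue lengths is a Lyapunov function. The load condition is imposed
  only on the queue-weighted total: shortest-queue routing meets it there, although the arrival rate
  at a single vertex may exceed its service rate in some states.\<close>

lemma stable_queue_rates:
  fixes a :: "('v::finite \<Rightarrow> nat) \<Rightarrow> 'v \<Rightarrow> real"
  assumes a: "\<And>x v. a x v \<ge> 0" "\<And>x. (\<Sum>v\<in>UNIV. a x v) \<le> C" and mu: "\<And>v. mu v > 0"
    and rho: "rho < 1"
    and load: "\<And>x. (\<Sum>v\<in>UNIV. a x v * real (x v)) \<le> rho * (\<Sum>v\<in>UNIV. mu v * real (x v))"
  shows "stable_chain (queue_rates a mu)"
proof -
  define L where "L = C + (\<Sum>v\<in>UNIV. mu v)"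
  have "0 \<le> (\<Sum>v\<in>UNIV. a undefined v)"
    by (intro sum_nonneg a)
  with a(2)[of undefined] have "C \<ge> 0" by linarith
  moreover have "(\<Sum>v\<in>UNIV. mu v) > 0"
    by (intro sum_pos mu) auto
  ultimately have L: "L > 0" by (simp add: L_def)
  have total: "(\<Sum>v\<in>UNIV. a x v) + (\<Sum>v\<in>UNIV. mu v) \<le> L" for x
    using a(2) by (simp add: L_def)
  obtain K where K: "\<And>x. finite (set_pmf (K x))"
      "\<And>x y. y \<noteq> x \<Longrightarrow> queue_rates a mu x y = L * pmf (K x) y"
    and gen: "\<And>x (h :: ('v \<Rightarrow> nat) \<Rightarrow> real). L * ((\<integral>y. h y \<partial>measure_pmf (K x)) - h x) =
      (\<Sum>v\<in>UNIV. a x v * (h (x(v := x v + 1)) - h x)) +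
      (\<Sum>v\<in>UNIV. mu v * (h (x(v := x v - 1)) - h x))"
    by (rule ex_queue_kernel[of a mu L, OF a(1) less_imp_le[OF mu] L total]) (rule that; assumption)
  define V :: "('v \<Rightarrow> nat) \<Rightarrow> real" where "V x = (\<Sum>v\<in>UNIV. (real (x v))\<^sup>2)" for x
  \<comment> \<open>Chosen so that \<open>L * f x\<close> equals \<open>2 * (1 - rho)\<close> times
    the weighted queue length, the negative part of the drift. The bounded part is at most
    \<open>L\<close>, whence the constant \<open>1\<close> in the drift condition.\<close>
  define b where "b = 2 * (1 - rho) / L"
  define f :: "('v \<Rightarrow> nat) \<Rightarrow> real" where "f x = b * (\<Sum>v\<in>UNIV. mu v * real (x v))" for x
  have b: "b > 0" using rho L by (simp add: b_def)
  have V_upd: "V (x(v := k)) - V x = (real k)\<^sup>2 - (real (x v))\<^sup>2" for x v k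
  proof -
    have "(\<Sum>u\<in>UNIV - {v}. (real ((x(v := k)) u))\<^sup>2) = (\<Sum>u\<in>UNIV - {v}. (real (x u))\<^sup>2)"
      by (intro sum.cong) auto
    then show ?thesis
      by (simp add: V_def sum.remove[of UNIV v])
  qed
  have drift: "(\<integral>y. V y \<partial>measure_pmf (K x)) \<le> V x + 1 - f x" for x
  proof -
    let ?S = "\<Sum>v\<in>UNIV. mu v * real (x v)"
    have "L * ((\<integral>y. V y \<partial>measure_pmf (K x)) - V x) \<le>
      (\<Sum>v\<in>UNIV. a x v * (2 * real (x v) + 1)) + (\<Sum>v\<in>UNIV. mu v * (1 - 2 * real (x v)))"
      unfolding gen
    proof (intro add_mono sum_mono mult_left_mono a less_imp_le[OF mu])
      fix v
      show "V (x(v := x v + 1)) - V x \<le> 2 * real (x v) + 1"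
        unfolding V_upd by (simp add: power2_eq_square algebra_simps)
      \<comment> \<open>Equality at a busy vertex; at an empty one the left side is \<open>0\<close>
        and the right side is \<open>1\<close>.\<close>
      show "V (x(v := x v - 1)) - V x \<le> 1 - 2 * real (x v)"
        unfolding V_upd by (cases "x v") (simp_all add: power2_eq_square algebra_simps)
    qed
    also have "\<dots> = 2 * (\<Sum>v\<in>UNIV. a x v * real (x v)) - 2 * ?S + ((\<Sum>v\<in>UNIV. a x v) + (\<Sum>v\<in>UNIV. mu v))"
      by (simp add: algebra_simps sum.distrib sum_subtractf sum_distrib_left)
    also have "\<dots> \<le> 2 * (rho * ?S) - 2 * ?S + L"
      using load[of x] total[of x] by linarith
    also have "\<dots> = L * (1 - f x)"
      using L by (simp add: f_def b_def field_simps)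
    finally show ?thesis
      using L by simp
  qed
  have "\<exists>\<pi>. bind_pmf \<pi> K = \<pi>"
  proof (rule drift_imp_invariant_distribution[OF K(1) _ _ _ drift])
    show "V x \<ge> 0" "f x \<ge> 0" for x
      by (auto simp: V_def f_def intro!: sum_nonneg mult_nonneg_nonneg less_imp_le[OF b] less_imp_le[OF mu])
    show "finite {x. f x \<le> R}" for R
    proof (rule finite_subset)
      show "{x. f x \<le> R} \<subseteq> PiE UNIV (\<lambda>v. {..nat \<lceil>R / (b * mu v)\<rceil>})"
      proof safe
        fix x v assume "f x \<le> R"
        have "b * (mu v * real (x v)) \<le> f x"
          unfolding f_def using b
          by (intro mult_left_mono member_le_sum) (simp_all add: less_imp_le[OF mu])
        with \<open>f x \<le> R\<close> have "real (x v) \<le> R / (b * mu v)"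
          using b mu[of v] by (simp add: field_simps)
        then show "x v \<le> nat \<lceil>R / (b * mu v)\<rceil>"
          by linarith
      qed auto
    qed (intro finite_PiE, auto)
  qed
  then obtain \<pi> where "bind_pmf \<pi> K = \<pi>" by blast
  with L K(2) show ?thesis
    by (rule stable_chain_of_invariant[where K = K and \<pi> = \<pi>])
qed

section \<open>Mean arrival rates in equilibrium\<close>

text \<open>The flow is balanced across the cuts \<open>{x. x v \<le> n}\<close>, instead of using the drift of \<open>x v\<close>,
  because \<open>x v\<close> might not be integrable under \<open>\<pi>\<close>.\<close>

lemma stationary_cut:
  fixes a :: "('v::finite \<Rightarrow> nat) \<Rightarrow> 'v \<Rightarrow> real"
  assumes P: "markov_chain_with_rates (queue_rates a mu) P" "stationary_distribution P \<pi>"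
    and a: "\<And>x v. a x v \<ge> 0" "\<And>x. (\<Sum>v\<in>UNIV. a x v) \<le> C" and mu: "\<And>v. mu v > 0"
  shows "(\<integral>x. of_bool (x v = n) * a x v \<partial>measure_pmf \<pi>) = mu v * measure (measure_pmf \<pi>) {x. x v = Suc n}"
proof -
  let ?A = "{x :: 'v \<Rightarrow> nat. x v \<le> n}" and ?q = "queue_rates a mu"
  have bound: "(\<Sum>\<^sub>\<infinity>y\<in>- {x}. ?q x y) \<le> C + (\<Sum>v\<in>UNIV. mu v)" for x
    unfolding infsum_queue_rates
    by (intro add_mono order_trans[OF sum_mono2 a(2)] sum_mono2) (auto simp: a less_imp_le[OF mu])
  \<comment> \<open>Jumps change one coordinate by one, so the only upward crossing is an arrival at
    \<open>v\<close> from level \<open>n\<close>; the downward one is a service at \<open>v\<close>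
    from level \<open>Suc n\<close>.\<close>
  have up: "indicat_real ?A x * (\<Sum>\<^sub>\<infinity>y\<in>- ?A. ?q x y) = of_bool (x v = n) * a x v" for x
  proof (cases "x v \<le> n")
    case True
    then have "{u. x(u := x u + 1) \<in> - ?A} = (if x v = n then {v} else {})"
      "{u. x u > 0 \<and> x(u := x u - 1) \<in> - ?A} = {}"
      by (auto split: if_splits)
    with True show ?thesis
      by (simp only: infsum_queue_rates) auto
  qed auto
  have down: "indicat_real (- ?A) x * (\<Sum>\<^sub>\<infinity>y\<in>?A. ?q x y) = mu v * indicat_real {x. x v = Suc n} x" for x
  proof (cases "x v \<le> n")
    case False
    then have "{u. x(u := x u + 1) \<in> ?A} = {}"
      "{u. x u > 0 \<and> x(u := x u - 1) \<in> ?A} = (if x v = Suc n then {v} else {})"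
      by (auto split: if_splits)
    with False show ?thesis
      by (simp only: infsum_queue_rates) auto
  qed auto
  from stationary_balance[OF P finite_queue_rates_support bound, of ?A]
  show ?thesis
    by (simp add: up down)
qed

text \<open>Adding up the cut equations equates the mean arrival rate with \<open>mu v\<close> times
  the probability that \<open>v\<close> is busy. Strictness holds because \<open>v\<close> is empty
  with positive probability.\<close>

lemma stationary_load_less:
  fixes a :: "('v::finite \<Rightarrow> nat) \<Rightarrow> 'v \<Rightarrow> real"
  assumes P: "markov_chain_with_rates (queue_rates a mu) P" "stationary_distribution P \<pi>"
    and a: "\<And>x v. a x v \<ge> 0" "\<And>x. (\<Sum>v\<in>UNIV. a x v) \<le> C" and mu: "\<And>v. mu v > 0"
  shows "(\<integral>x. a x v \<partial>measure_pmf \<pi>) < mu v"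
proof -
  let ?pr = "\<lambda>A. measure (measure_pmf \<pi>) A"
  note cut = stationary_cut[OF P a mu, of v]
  have a_le: "a x v \<le> C" for x
    using member_le_sum[of v UNIV "a x"] a(1) a(2)[of x] by fastforce
  have int: "integrable (measure_pmf \<pi>) (\<lambda>x. of_bool (Q x) * a x v)" for Q
    by (intro integrable_measure_pmf_bounded[where B = C])
       (use a(1)[of _ v] a_le order_trans[OF a(1) a_le] in \<open>auto simp: of_bool_def\<close>)
  have empty: "?pr {x. x v = 0} > 0"
  proof (rule ccontr)
    assume "\<not> ?pr {x. x v = 0} > 0"
    then have zero: "?pr {x. x v = 0} = 0"
      by (simp add: zero_less_measure_iff)
    \<comment> \<open>If level \<open>0\<close> had probability zero, the cut equations would pass
      this on from each level to the next, and no state would be left to carry mass.\<close>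
    have all: "?pr {x. x v = n} = 0" for n
    proof (induction n)
      case (Suc n)
      have "mu v * ?pr {x. x v = Suc n} \<le> (\<integral>x. C * indicat_real {x. x v = n} x \<partial>measure_pmf \<pi>)"
        unfolding cut[symmetric]
      proof (rule integral_mono[OF int])
        show "integrable (measure_pmf \<pi>) (\<lambda>x. C * indicat_real {x. x v = n} x)"
          by (rule integrable_measure_pmf_bounded[where B = "\<bar>C\<bar>"]) (auto split: split_indicator)
      qed (use a_le in auto)
      also have "\<dots> = 0" by (simp add: Suc)
      finally show ?case
        using mu[of v] by (simp add: mult_le_0_iff measure_le_0_iff)
    qed (rule zero)
    obtain x where "x \<in> set_pmf \<pi>"
      using set_pmf_not_empty[of \<pi>] by blast
    then have "0 < ?pr {x}"
      by (simp add: measure_pmf_single pmf_positive)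
    also have "\<dots> \<le> ?pr {y. y v = x v}"
      by (intro measure_pmf.finite_measure_mono) auto
    finally show False by (simp add: all)
  qed
  have part: "(\<integral>x. of_bool (x v < N) * a x v \<partial>measure_pmf \<pi>) = mu v * ?pr {x. 0 < x v \<and> x v \<le> N}" for N
  proof (induction N)
    case 0
    have "{x :: 'v \<Rightarrow> nat. 0 < x v \<and> x v \<le> 0} = {}" by auto
    then have zero: "?pr {x. 0 < x v \<and> x v \<le> 0} = 0" by (simp only: measure_empty)
    show ?case unfolding zero by simp
  next
    case (Suc N)
    have "(\<integral>x. of_bool (x v < Suc N) * a x v \<partial>measure_pmf \<pi>) =
        (\<integral>x. of_bool (x v < N) * a x v + of_bool (x v = N) * a x v \<partial>measure_pmf \<pi>)"
      by (intro Bochner_Integration.integral_cong) auto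
    also have "\<dots> = mu v * (?pr {x. 0 < x v \<and> x v \<le> N} + ?pr {x. x v = Suc N})"
      by (simp add: int Suc cut distrib_left)
    also have "?pr {x. 0 < x v \<and> x v \<le> N} + ?pr {x. x v = Suc N} =
        ?pr ({x. 0 < x v \<and> x v \<le> N} \<union> {x. x v = Suc N})"
      by (intro measure_pmf.finite_measure_Union[symmetric]) auto
    also have "{x. 0 < x v \<and> x v \<le> N} \<union> {x. x v = Suc N} = {x. 0 < x v \<and> x v \<le> Suc N}"
      by auto
    finally show ?case .
  qed
  have "(\<lambda>N. \<integral>x. of_bool (x v < N) * a x v \<partial>measure_pmf \<pi>) \<longlonglongrightarrow> (\<integral>x. a x v \<partial>measure_pmf \<pi>)"
  proof (rule integral_dominated_convergence[where w = "\<lambda>_. C"])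
    show "AE x in measure_pmf \<pi>. (\<lambda>N. of_bool (x v < N) * a x v) \<longlonglongrightarrow> a x v"
    proof (rule AE_I2)
      fix x
      have "\<forall>\<^sub>F N in sequentially. of_bool (x v < N) * a x v = a x v"
        using eventually_gt_at_top[of "x v"] by eventually_elim simp
      then show "(\<lambda>N. of_bool (x v < N) * a x v) \<longlonglongrightarrow> a x v"
        by (rule tendsto_eventually)
    qed
    show "AE x in measure_pmf \<pi>. norm (of_bool (x v < N) * a x v) \<le> C" for N
      by (rule AE_I2) (use a(1)[of _ v] a_le order_trans[OF a(1) a_le] in \<open>auto simp: of_bool_def\<close>)
  qed auto
  moreover have "(\<integral>x. of_bool (x v < N) * a x v \<partial>measure_pmf \<pi>) \<le> mu v * (1 - ?pr {x. x v = 0})" for N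
  proof -
    have "?pr {x. 0 < x v \<and> x v \<le> N} \<le> ?pr (- {x. x v = 0})"
      by (intro measure_pmf.finite_measure_mono) auto
    also have "\<dots> = 1 - ?pr {x. x v = 0}"
      using measure_pmf.prob_compl[of "{x. x v = 0}" \<pi>] by (simp add: Compl_eq_Diff_UNIV)
    finally show ?thesis
      unfolding part using mu[of v] by (intro mult_left_mono) auto
  qed
  ultimately have "(\<integral>x. a x v \<partial>measure_pmf \<pi>) \<le> mu v * (1 - ?pr {x. x v = 0})"
    by (intro LIMSEQ_le_const2) auto
  also have "\<dots> < mu v"
    using mu[of v] empty by (simp add: algebra_simps)
  finally show ?thesis .
qed

subsection \<open>Static and shortest-queue allocations\<close>

lemma sum_edges_at:
  fixes E :: "'v::finite set set"
  shows "(\<Sum>v\<in>UNIV. \<Sum>e\<in>edges_at E v. g v e) = (\<Sum>e\<in>E. \<Sum>v\<in>e. g v e)"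
proof -
  have "(\<Sum>v\<in>UNIV. \<Sum>e\<in>edges_at E v. g v e) = (\<Sum>v\<in>UNIV. \<Sum>e\<in>E. if v \<in> e then g v e else 0)"
    by (simp add: edges_at_def sum.inter_filter)
  also have "\<dots> = (\<Sum>e\<in>E. \<Sum>v\<in>UNIV. if v \<in> e then g v e else 0)"
    by (rule sum.swap)
  also have "\<dots> = (\<Sum>e\<in>E. \<Sum>v\<in>e. g v e)"
    by (simp add: sum.If_cases)
  finally show ?thesis .
qed

lemma static_arrival_nonneg:
  assumes "static_allocation E p" "\<And>e. e \<in> E \<Longrightarrow> lam e > 0"
  shows "static_arrival E lam p v \<ge> 0"
  unfolding static_arrival_def
proof (intro sum_nonneg mult_nonneg_nonneg)
  fix e assume "e \<in> edges_at E v"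
  then show "p v e \<ge> 0" "lam e \<ge> 0"
    using assms less_imp_le[OF assms(2)] by (auto simp: static_allocation_def edges_at_def)
qed

lemma max_load_less_iff:
  fixes E :: "'v::finite set set"
  assumes mu: "\<And>v. mu v > 0"
  shows "max_load E lam mu p < c \<longleftrightarrow> (\<forall>v. static_arrival E lam p v < c * mu v)"
proof -
  have "max_load E lam mu p < c \<longleftrightarrow> (\<forall>v. 1 / mu v * static_arrival E lam p v < c)"
    unfolding max_load_def static_arrival_def[symmetric] by (subst Max_less_iff) auto
  with mu show ?thesis
    by (simp add: pos_divide_less_eq)
qed

lemma max_load_le_iff:
  fixes E :: "'v::finite set set"
  assumes mu: "\<And>v. mu v > 0"
  shows "max_load E lam mu p \<le> c \<longleftrightarrow> (\<forall>v. static_arrival E lam p v \<le> c * mu v)"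
proof -
  have "max_load E lam mu p \<le> c \<longleftrightarrow> (\<forall>v. 1 / mu v * static_arrival E lam p v \<le> c)"
    unfolding max_load_def static_arrival_def[symmetric] by (subst Max_le_iff) auto
  with mu show ?thesis
    by (simp add: pos_divide_le_eq)
qed

text \<open>Provides the lower bound needed to reason about the infimum of the loads in the
  reals.\<close>

lemma max_load_nonneg:
  fixes E :: "'v::finite set set"
  assumes "static_allocation E p" "\<And>e. e \<in> E \<Longrightarrow> lam e > 0" "\<And>v. mu v > 0"
  shows "max_load E lam mu p \<ge> 0"
proof (rule ccontr)
  assume "\<not> max_load E lam mu p \<ge> 0"
  then have "static_arrival E lam p undefined < 0"
    using max_load_less_iff[of mu E lam p 0] assms(3) by auto
  with static_arrival_nonneg[OF assms(1,2)] show False by (simp add: not_less[symmetric])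
qed

text \<open>The arrival rates do not depend on the state, so their stationary means are the rates
  themselves. Conversely \<open>max_load\<close> itself serves as \<open>rho\<close>.\<close>

lemma stable_static_rates_iff:
  fixes E :: "'v::finite set set"
  assumes p: "static_allocation E p" and lam: "\<And>e. e \<in> E \<Longrightarrow> lam e > 0" and mu: "\<And>v. mu v > 0"
  shows "stable_chain (static_rates E lam mu p) \<longleftrightarrow> max_load E lam mu p < 1"
proof
  assume "stable_chain (static_rates E lam mu p)"
  then obtain P \<pi> where P: "markov_chain_with_rates (static_rates E lam mu p) P"
    "stationary_distribution P \<pi>"
    by (auto simp: stable_chain_def)
  have "static_arrival E lam p v < mu v" for v
    using stationary_load_less[OF P[unfolded static_rates_def] static_arrival_nonneg[OF p lam]
        order_refl mu, of v] by simp
  then show "max_load E lam mu p < 1"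
    by (simp add: max_load_less_iff mu)
next
  assume less: "max_load E lam mu p < 1"
  have "static_arrival E lam p v \<le> max_load E lam mu p * mu v" for v
    using max_load_le_iff[of mu E lam p "max_load E lam mu p"] mu by simp
  then have "(\<Sum>v\<in>UNIV. static_arrival E lam p v * real (x v)) \<le>
      max_load E lam mu p * (\<Sum>v\<in>UNIV. mu v * real (x v))" for x
    unfolding sum_distrib_left mult.assoc[symmetric] by (intro sum_mono mult_right_mono) auto
  then show "stable_chain (static_rates E lam mu p)"
    unfolding static_rates_def by (intro stable_queue_rates[OF static_arrival_nonneg[OF p lam]
        order_refl mu less])
qed

text \<open>The routing probability under join-the-shortest-queue. With it the dynamic arrival rates
  take the form of static ones for an allocation depending on the state.\<close>

definition jsq_weight :: "('v \<Rightarrow> nat) \<Rightarrow> 'v \<Rightarrow> 'v set \<Rightarrow> real" where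
  "jsq_weight x v e = of_bool (v \<in> shortest_queues x e) / real (card (shortest_queues x e))"

lemma jsq_weight_nonneg: "jsq_weight x v e \<ge> 0"
  by (simp add: jsq_weight_def)

lemma jsq_weight_le_1:
  fixes e :: "'v::finite set"
  shows "jsq_weight x v e \<le> 1"
  by (auto simp: jsq_weight_def divide_simps Suc_le_eq card_gt_0_iff)

lemma shortest_queues_nonempty:
  fixes e :: "'v::finite set"
  assumes "e \<noteq> {}"
  shows "shortest_queues x e \<noteq> {}"
proof -
  have "Min (x ` e) \<in> x ` e"
    using assms by (intro Min_in) auto
  then obtain u where "u \<in> e" "x u = Min (x ` e)"
    by (metis imageE)
  then show ?thesis
    by (auto simp: shortest_queues_def)
qed

text \<open>The weights are uniform on the minimizers of \<open>x\<close> over \<open>e\<close>, so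
  the mean queue length that they select is the minimum.\<close>

lemma sum_jsq_weight:
  fixes e :: "'v::finite set"
  assumes "e \<noteq> {}"
  shows "(\<Sum>v\<in>e. jsq_weight x v e * real (x v)) = real (Min (x ` e))"
    and "(\<Sum>v\<in>e. jsq_weight x v e) = 1"
proof -
  let ?S = "shortest_queues x e"
  have sub: "?S \<subseteq> e" by (auto simp: shortest_queues_def)
  have eq: "(\<Sum>v\<in>e. jsq_weight x v e * g v) = (\<Sum>v\<in>?S. g v / real (card ?S))" for g
    using sub by (intro sum.mono_neutral_cong_right) (auto simp: jsq_weight_def)
  show "(\<Sum>v\<in>e. jsq_weight x v e) = 1"
    using eq[of "\<lambda>_. 1"] shortest_queues_nonempty[OF assms] by simp
  have "(\<Sum>v\<in>?S. real (x v) / real (card ?S)) = (\<Sum>v\<in>?S. real (Min (x ` e)) / real (card ?S))"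
    by (intro sum.cong) (auto simp: shortest_queues_def)
  with eq[of "\<lambda>v. real (x v)"] shortest_queues_nonempty[OF assms]
  show "(\<Sum>v\<in>e. jsq_weight x v e * real (x v)) = real (Min (x ` e))"
    by simp
qed

lemma jsq_arrival_eq: "jsq_arrival E lam x v = (\<Sum>e\<in>edges_at E v. jsq_weight x v e * lam e)"
  by (simp add: jsq_arrival_def jsq_weight_def mult.commute)

lemma jsq_arrival_nonneg:
  assumes "\<And>e. e \<in> E \<Longrightarrow> lam e > 0"
  shows "jsq_arrival E lam x v \<ge> 0"
  unfolding jsq_arrival_eq using assms
  by (intro sum_nonneg mult_nonneg_nonneg jsq_weight_nonneg) (auto simp: edges_at_def less_imp_le)

lemma sum_jsq_arrival:
  fixes E :: "'v::finite set set"
  assumes "\<And>e. e \<in> E \<Longrightarrow> e \<noteq> {}"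
  shows "(\<Sum>v\<in>UNIV. jsq_arrival E lam x v) = (\<Sum>e\<in>E. lam e)"
  unfolding jsq_arrival_eq sum_edges_at
  by (intro sum.cong refl) (simp add: sum_distrib_right[symmetric] sum_jsq_weight assms)

text \<open>Joining the shortest queue minimizes the drift of \<open>\<Sum>v. (x v)\<^sup>2\<close> among all allocations.\<close>

lemma jsq_arrival_le_static:
  fixes E :: "'v::finite set set"
  assumes E: "\<And>e. e \<in> E \<Longrightarrow> e \<noteq> {}" and lam: "\<And>e. e \<in> E \<Longrightarrow> lam e > 0"
    and p: "static_allocation E p"
  shows "(\<Sum>v\<in>UNIV. jsq_arrival E lam x v * real (x v)) \<le>
    (\<Sum>v\<in>UNIV. static_arrival E lam p v * real (x v))"
proof -
  have "(\<Sum>v\<in>UNIV. jsq_arrival E lam x v * real (x v)) =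
      (\<Sum>e\<in>E. (\<Sum>v\<in>e. jsq_weight x v e * real (x v)) * lam e)"
    unfolding jsq_arrival_eq sum_distrib_right sum_edges_at by (simp add: mult_ac)
  also have "\<dots> \<le> (\<Sum>e\<in>E. (\<Sum>v\<in>e. p v e * real (x v)) * lam e)"
  proof (rule sum_mono, rule mult_right_mono)
    fix e assume e: "e \<in> E"
    then have p': "(\<Sum>v\<in>e. p v e) = 1" "\<And>v. v \<in> e \<Longrightarrow> p v e \<ge> 0"
      using p by (auto simp: static_allocation_def)
    have "real (Min (x ` e)) = (\<Sum>v\<in>e. p v e * real (Min (x ` e)))"
      by (simp add: sum_distrib_right[symmetric] p')
    \<comment> \<open>The minimum over an edge is at most any weighted average over it.\<close>
    also have "\<dots> \<le> (\<Sum>v\<in>e. p v e * real (x v))"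
      by (intro sum_mono mult_left_mono p') auto
    finally show "(\<Sum>v\<in>e. jsq_weight x v e * real (x v)) \<le> (\<Sum>v\<in>e. p v e * real (x v))"
      by (simp add: sum_jsq_weight E e)
    show "lam e \<ge> 0" using lam[OF e] by simp
  qed
  also have "\<dots> = (\<Sum>v\<in>UNIV. static_arrival E lam p v * real (x v))"
    unfolding static_arrival_def sum_distrib_right sum_edges_at by (simp add: mult_ac)
  finally show ?thesis .
qed

lemma stable_jsq_rates_iff:
  fixes E :: "'v::finite set set"
  assumes E: "\<And>e. e \<in> E \<Longrightarrow> e \<noteq> {}" and lam: "\<And>e. e \<in> E \<Longrightarrow> lam e > 0" and mu: "\<And>v. mu v > 0"
  shows "stable_chain (jsq_rates E lam mu) \<longleftrightarrow> (\<exists>p. static_allocation E p \<and> max_load E lam mu p < 1)"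
proof
  assume "stable_chain (jsq_rates E lam mu)"
  then obtain P \<pi> where P: "markov_chain_with_rates (jsq_rates E lam mu) P"
    "stationary_distribution P \<pi>"
    by (auto simp: stable_chain_def)
  \<comment> \<open>The stationary mean of the routing probabilities. Expectation commutes with the
    finite sums over vertices and edges, so \<open>p\<close> is an allocation whose arrival rates
    are the mean arrival rates of the dynamic chain.\<close>
  define p where "p v e = (\<integral>x. jsq_weight x v e \<partial>measure_pmf \<pi>)" for v e
  have int: "integrable (measure_pmf \<pi>) (\<lambda>x. jsq_weight x v e)" for v e
    by (rule integrable_measure_pmf_bounded[where B = 1]) (simp add: jsq_weight_nonneg jsq_weight_le_1)
  have "static_allocation E p"
    unfolding static_allocation_def
  proof (intro ballI conjI)
    fix e assume "e \<in> E"
    show "p v e \<ge> 0" for v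
      by (simp add: p_def integral_nonneg_AE jsq_weight_nonneg)
    have "(\<Sum>v\<in>e. p v e) = (\<integral>x. (\<Sum>v\<in>e. jsq_weight x v e) \<partial>measure_pmf \<pi>)"
      by (simp add: p_def int)
    then show "(\<Sum>v\<in>e. p v e) = 1"
      by (simp add: sum_jsq_weight E \<open>e \<in> E\<close>)
  qed
  moreover have "static_arrival E lam p v < mu v" for v
  proof -
    have "static_arrival E lam p v = (\<integral>x. jsq_arrival E lam x v \<partial>measure_pmf \<pi>)"
      by (simp add: static_arrival_def jsq_arrival_eq p_def int)
    also have "\<dots> < mu v"
      by (rule stationary_load_less[OF P[unfolded jsq_rates_def] jsq_arrival_nonneg[OF lam]
            eq_refl[OF sum_jsq_arrival[OF E]] mu])
    finally show ?thesis .
  qed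
  ultimately show "\<exists>p. static_allocation E p \<and> max_load E lam mu p < 1"
    by (auto simp: max_load_less_iff mu)
next
  assume "\<exists>p. static_allocation E p \<and> max_load E lam mu p < 1"
  then obtain p where p: "static_allocation E p" and less: "max_load E lam mu p < 1" by blast
  have load: "static_arrival E lam p v \<le> max_load E lam mu p * mu v" for v
    using max_load_le_iff[of mu E lam p "max_load E lam mu p"] mu by simp
  have "(\<Sum>v\<in>UNIV. jsq_arrival E lam x v * real (x v)) \<le>
      max_load E lam mu p * (\<Sum>v\<in>UNIV. mu v * real (x v))" for x
  proof -
    have "(\<Sum>v\<in>UNIV. jsq_arrival E lam x v * real (x v)) \<le>
        (\<Sum>v\<in>UNIV. static_arrival E lam p v * real (x v))"
      by (rule jsq_arrival_le_static[OF E lam p])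
    also have "\<dots> \<le> max_load E lam mu p * (\<Sum>v\<in>UNIV. mu v * real (x v))"
      unfolding sum_distrib_left mult.assoc[symmetric] by (intro sum_mono mult_right_mono load) auto
    finally show ?thesis .
  qed
  then show "stable_chain (jsq_rates E lam mu)"
    unfolding jsq_rates_def by (intro stable_queue_rates[OF jsq_arrival_nonneg[OF lam]
        eq_refl[OF sum_jsq_arrival[OF E]] mu less])
qed

section \<open>Existence of an optimal static allocation\<close>

lemma ex_static_allocation:
  fixes E :: "'v::finite set set"
  assumes "\<And>e. e \<in> E \<Longrightarrow> e \<noteq> {}"
  shows "\<exists>p. static_allocation E p"
  \<comment> \<open>When all queues are equal, the shortest-queue weights are uniform on each
    edge.\<close>
  using assms
  by (intro exI[of _ "jsq_weight (\<lambda>_. 0)"]) (auto simp: static_allocation_def jsq_weight_nonneg sum_jsq_weight)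

lemma static_allocation_le_1:
  fixes E :: "'v::finite set set"
  assumes "static_allocation E p" "e \<in> E" "v \<in> e"
  shows "p v e \<le> 1"
  using member_le_sum[of v e "\<lambda>v. p v e"] assms by (auto simp: static_allocation_def)

text \<open>Compactness: a minimizing sequence has a subsequence converging at every incident pair
  \<open>(v, e)\<close>, and both the allocation constraints and the load bounds pass to the
  limit.\<close>

lemma ex_min_max_load:
  fixes E :: "'v::finite set set"
  assumes E: "\<And>e. e \<in> E \<Longrightarrow> e \<noteq> {}" and lam: "\<And>e. e \<in> E \<Longrightarrow> lam e > 0" and mu: "\<And>v. mu v > 0"
  shows "\<exists>p. is_arg_min (max_load E lam mu) (static_allocation E) p"
proof -
  let ?A = "{p. static_allocation E p}" and ?f = "max_load E lam mu"
  define m where "m = (INF p\<in>?A. ?f p)"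
  have ne: "?A \<noteq> {}"
    using ex_static_allocation[OF E] by simp
  have bdd: "bdd_below (?f ` ?A)"
    by (rule bdd_belowI2[where m = 0]) (simp add: max_load_nonneg lam mu)
  have "\<exists>p. static_allocation E p \<and> ?f p < m + 1 / real (Suc n)" for n
    using cINF_less_iff[OF ne bdd, of "m + 1 / real (Suc n)"] by (auto simp: m_def)
  then obtain p where p: "\<And>n. static_allocation E (p n)" "\<And>n. ?f (p n) < m + 1 / real (Suc n)"
    by metis
  \<comment> \<open>Values of an allocation off the incident pairs are arbitrary; replacing them by
    \<open>0\<close> makes the sequence bounded, as the selection of a subsequence requires.\<close>
  define r where "r n ve = (if snd ve \<in> E \<and> fst ve \<in> snd ve then p n (fst ve) (snd ve) else 0)" for n ve
  have r_le: "norm (r n ve) \<le> 1" for n ve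
    using p(1)[of n] static_allocation_le_1[OF p(1), of "snd ve" "fst ve" n]
    by (auto simp: r_def static_allocation_def)
  obtain k where k: "strict_mono k" and conv: "\<And>ve. \<exists>l. (\<lambda>n. r (k n) ve) \<longlonglongrightarrow> l"
    by (rule function_convergent_subsequence[of "UNIV :: ('v \<times> 'v set) set" r 1]) (use r_le in auto)
  define l where "l v e = lim (\<lambda>n. r (k n) (v, e))" for v e
  have l: "(\<lambda>n. p (k n) v e) \<longlonglongrightarrow> l v e" if "e \<in> E" "v \<in> e" for v e
    using conv[of "(v, e)"] that
    by (auto simp: l_def r_def convergent_def[symmetric] convergent_LIMSEQ_iff)
  have alloc: "static_allocation E l"
    unfolding static_allocation_def
  proof (intro ballI conjI)
    fix e assume e: "e \<in> E"
    show "l v e \<ge> 0" if "v \<in> e" for v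
      by (rule LIMSEQ_le_const[OF l[OF e that]])
         (use p(1) e that in \<open>auto simp: static_allocation_def\<close>)
    have "(\<lambda>n. \<Sum>v\<in>e. p (k n) v e) \<longlonglongrightarrow> (\<Sum>v\<in>e. l v e)"
      by (intro tendsto_sum l e)
    moreover have "(\<Sum>v\<in>e. p (k n) v e) = 1" for n
      using p(1)[of "k n"] e by (simp add: static_allocation_def)
    ultimately show "(\<Sum>v\<in>e. l v e) = 1"
      by (simp add: LIMSEQ_const_iff)
  qed
  \<comment> \<open>The limit is taken vertex by vertex, which avoids a continuity argument for the
    maximum.\<close>
  have "static_arrival E lam l v \<le> m * mu v" for v
  proof (rule LIMSEQ_le)
    show "(\<lambda>n. static_arrival E lam (p (k n)) v) \<longlonglongrightarrow> static_arrival E lam l v"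
      unfolding static_arrival_def by (intro tendsto_intros l) (auto simp: edges_at_def)
    have "(\<lambda>n. (m + 1 / real (Suc (k n))) * mu v) \<longlonglongrightarrow> (m + 0) * mu v"
      using LIMSEQ_subseq_LIMSEQ[OF LIMSEQ_Suc[OF lim_1_over_n] k]
      by (intro tendsto_intros) (simp add: o_def)
    then show "(\<lambda>n. (m + 1 / real (Suc (k n))) * mu v) \<longlonglongrightarrow> m * mu v" by simp
    have "static_arrival E lam (p n) v \<le> (m + 1 / real (Suc n)) * mu v" for n
      using p(2)[of n] max_load_less_iff[of mu E lam "p n" "m + 1 / real (Suc n)"] mu
      by (auto intro: less_imp_le)
    then show "\<exists>N. \<forall>n\<ge>N. static_arrival E lam (p (k n)) v \<le> (m + 1 / real (Suc (k n))) * mu v"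
      by blast
  qed
  then have "?f l \<le> m"
    by (simp add: max_load_le_iff mu)
  moreover have "m \<le> ?f y" if "static_allocation E y" for y
    unfolding m_def using bdd that by (intro cINF_lower) auto
  ultimately have "is_arg_min ?f (static_allocation E) l"
    using alloc by (auto simp: is_arg_min_def not_less intro: order_trans)
  then show ?thesis by blast
qed

theorem theorem1:
  fixes E :: "'v::finite set set"
    and lam :: "'v set \<Rightarrow> real"
    and mu :: "'v \<Rightarrow> real"
  assumes "\<And>e. e \<in> E \<Longrightarrow> e \<noteq> {}"
    and "\<And>e. e \<in> E \<Longrightarrow> lam e > 0"
    and "\<And>v. mu v > 0"
  shows "(stable_chain (jsq_rates E lam mu) \<longleftrightarrow>
           (\<exists>p. static_allocation E p \<and> stable_chain (static_rates E lam mu p)))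
       \<and> (\<exists>p. is_arg_min (max_load E lam mu) (static_allocation E) p)
       \<and> (stable_chain (jsq_rates E lam mu) \<longleftrightarrow>
           (INF p\<in>{p. static_allocation E p}. max_load E lam mu p) < 1)"
proof (intro conjI)
  have jsq: "stable_chain (jsq_rates E lam mu) \<longleftrightarrow>
      (\<exists>p. static_allocation E p \<and> max_load E lam mu p < 1)"
    by (rule stable_jsq_rates_iff[OF assms])
  have static: "stable_chain (static_rates E lam mu p) \<longleftrightarrow> max_load E lam mu p < 1"
    if "static_allocation E p" for p
    by (rule stable_static_rates_iff[OF that assms(2,3)])
  show "stable_chain (jsq_rates E lam mu) \<longleftrightarrow>
      (\<exists>p. static_allocation E p \<and> stable_chain (static_rates E lam mu p))"
    using jsq static by auto
  show "\<exists>p. is_arg_min (max_load E lam mu) (static_allocation E) p"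
    by (rule ex_min_max_load[OF assms])
  \<comment> \<open>A bounded-below nonempty family of loads has infimum below \<open>1\<close>
    exactly if some load is below \<open>1\<close>.\<close>
  have "bdd_below (max_load E lam mu ` {p. static_allocation E p})"
    by (rule bdd_belowI2[where m = 0]) (simp add: max_load_nonneg assms)
  then show "stable_chain (jsq_rates E lam mu) \<longleftrightarrow>
      (INF p\<in>{p. static_allocation E p}. max_load E lam mu p) < 1"
    unfolding jsq using ex_static_allocation[OF assms(1)] by (subst cINF_less_iff) auto
qed

end
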